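(* Let $F$ be an algebraically closed field with $\operatorname{char}(F)=0$, let $A=M_n(F)$ with $n\ge 2$, and let $f\in F\langle \mathcal X\rangle$ be a polynomial which is neither an identity nor a central polynomial of $A$. Then $f(A)-f(A)$ contains all square-zero matrices in $A$ (i.e. all $u\in A$ with $u^2=0$).
   Context: $F\langle \mathcal X\rangle$ is the free (unital, associative) algebra over $F$ on $\mathcal X=\{X_1,X_2,\dots\}$, i.e. the algebra of noncommutative polynomials. For $f=f(X_1,\dots,X_m)$, $f(A)=\{f(a_1,\dots,a_m)\mid a_1,\dots,a_m\in A\}$ and $f(A)-f(A)=\{t-t'\mid t,t'\in f(A)\}$. $f$ is an identity of $A$ if $f(A)=\{0\}$; $f$ is a central polynomial of $A$ if $f(A)$ is contained in the center of $A$ but $f$ is not an identity of $A$ (a nonzero constant term is allowed). *)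

theory Defs
  imports
    "HOL-Computational_Algebra.Polynomial"
    "HOL-Library.Poly_Mapping"
    "Jordan_Normal_Form.Matrix"
begin

section \<open>The free algebra\<close>

text \<open>
  Words in the letters \<open>X\<^sub>0, X\<^sub>1, \<dots>\<close>, i.e. the free monoid on a countable alphabet. It is written
  additively because \<^typ>\<open>'k \<Rightarrow>\<^sub>0 'a\<close> turns addition of keys into multiplication of monomials. With
  this instance \<^theory>\<open>HOL-Library.Poly_Mapping\<close> makes \<open>nc_word \<Rightarrow>\<^sub>0 'a\<close> the monoid
  algebra of the free monoid, which is the free unital associative algebra.
\<close>

datatype nc_word = Word (letters: "nat list")

instantiation nc_word :: monoid_add
begin

definition zero_nc_word :: nc_word where
  "0 = Word []"

definition plus_nc_word :: "nc_word \<Rightarrow> nc_word \<Rightarrow> nc_word" where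
  "v + w = Word (letters v @ letters w)"

instance
  by standard (simp_all add: zero_nc_word_def plus_nc_word_def)

end

type_synonym 'a free_algebra = "nc_word \<Rightarrow>\<^sub>0 'a"

definition nc_var :: "nat \<Rightarrow> 'a::ring_1 free_algebra" where
  "nc_var i = Poly_Mapping.single (Word [i]) 1"


section \<open>Evaluation in matrix algebras\<close>

text \<open>The order of the factors is that of the letters, and the empty word gives the identity.\<close>

definition word_eval :: "nat \<Rightarrow> (nat \<Rightarrow> 'a::comm_ring_1 mat) \<Rightarrow> nc_word \<Rightarrow> 'a mat" where
  "word_eval n x w = foldr (\<lambda>i M. x i * M) (letters w) (1\<^sub>m n)"

definition nc_eval :: "nat \<Rightarrow> (nat \<Rightarrow> 'a::comm_ring_1 mat) \<Rightarrow> 'a free_algebra \<Rightarrow> 'a mat" where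
  "nc_eval n x f =
    (\<Oplus>\<^bsub>ring_mat TYPE('a) n ()\<^esub>w \<in> Poly_Mapping.keys f. Poly_Mapping.lookup f w \<cdot>\<^sub>m word_eval n x w)"

text \<open>
  The image \<open>f(M\<^sub>n(F))\<close>. All variables are assigned a matrix at once; those not occurring in \<open>f\<close>
  do not influence the value.
\<close>

definition nc_image :: "nat \<Rightarrow> 'a::comm_ring_1 free_algebra \<Rightarrow> 'a mat set" where
  "nc_image n f = {nc_eval n x f | x. \<forall>i. x i \<in> carrier_mat n n}"

definition mat_center :: "nat \<Rightarrow> 'a::comm_ring_1 mat set" where
  "mat_center n = {c \<in> carrier_mat n n. \<forall>a \<in> carrier_mat n n. c * a = a * c}"

definition is_identity :: "nat \<Rightarrow> 'a::comm_ring_1 free_algebra \<Rightarrow> bool" where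
  "is_identity n f \<longleftrightarrow> nc_image n f = {0\<^sub>m n n}"

definition is_central_polynomial :: "nat \<Rightarrow> 'a::comm_ring_1 free_algebra \<Rightarrow> bool" where
  "is_central_polynomial n f \<longleftrightarrow> nc_image n f \<subseteq> mat_center n \<and> \<not> is_identity n f"


section \<open>Evaluation is the algebra homomorphism given by the assignment\<close>

lemma word_eval_closed:
  assumes "\<And>i. x i \<in> carrier_mat n n"
  shows "word_eval n x w \<in> carrier_mat n n"
proof -
  have "foldr (\<lambda>i M. x i * M) l (1\<^sub>m n) \<in> carrier_mat n n" for l
    by (induction l) (auto intro!: mult_carrier_mat assms)
  then show ?thesis by (simp add: word_eval_def)
qed

lemma word_eval_zero: "word_eval n x 0 = 1\<^sub>m n"
  by (simp add: word_eval_def zero_nc_word_def)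

lemma word_eval_plus:
  assumes x: "\<And>i. x i \<in> carrier_mat n n"
  shows "word_eval n x (v + w) = word_eval n x v * word_eval n x w"
proof -
  have c: "foldr (\<lambda>i M. x i * M) l (1\<^sub>m n) \<in> carrier_mat n n" for l
    using word_eval_closed[of x n "Word l"] x by (simp add: word_eval_def)
  have "foldr (\<lambda>i M. x i * M) (k @ l) (1\<^sub>m n)
      = foldr (\<lambda>i M. x i * M) k (1\<^sub>m n) * foldr (\<lambda>i M. x i * M) l (1\<^sub>m n)" for k l
  proof (induction k)
    case Nil
    show ?case using left_mult_one_mat[OF c[of l]] by simp
  next
    case (Cons a k)
    then show ?case using assoc_mult_mat[OF x[of a] c[of k] c[of l]] by simp
  qed
  then show ?thesis by (simp add: word_eval_def plus_nc_word_def)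
qed

lemma finsum_ring_mat:
  fixes g :: "'b \<Rightarrow> 'a::comm_ring_1 mat"
  assumes "finite K" and "\<And>w. w \<in> K \<Longrightarrow> g w \<in> carrier_mat n n"
  shows "(\<Oplus>\<^bsub>ring_mat TYPE('a) n ()\<^esub>w \<in> K. g w) = mat n n (\<lambda>ij. \<Sum>w\<in>K. g w $$ ij)"
  using assms
proof (induction K rule: finite_induct)
  interpret R: ring "ring_mat TYPE('a) n ()" by (rule ring_mat)
  case empty
  show ?case by (auto simp: ring_mat_simps)
next
  interpret R: ring "ring_mat TYPE('a) n ()" by (rule ring_mat)
  case (insert a K)
  have "(\<Oplus>\<^bsub>ring_mat TYPE('a) n ()\<^esub>w \<in> insert a K. g w)
      = g a + (\<Oplus>\<^bsub>ring_mat TYPE('a) n ()\<^esub>w \<in> K. g w)"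
    using insert by (subst R.finsum_insert) (auto simp: ring_mat_simps)
  also have "\<dots> = mat n n (\<lambda>ij. \<Sum>w\<in>insert a K. g w $$ ij)"
    using insert by (intro eq_matI) auto
  finally show ?case .
qed

lemma nc_eval_superset:
  fixes f :: "'a::comm_ring_1 free_algebra"
  assumes x: "\<And>i. x i \<in> carrier_mat n n" and K: "finite K" "Poly_Mapping.keys f \<subseteq> K"
  shows "nc_eval n x f
    = mat n n (\<lambda>ij. \<Sum>w\<in>K. Poly_Mapping.lookup f w * word_eval n x w $$ ij)"
proof -
  note c = word_eval_closed[of x n, OF x]
  have "nc_eval n x f = mat n n (\<lambda>ij. \<Sum>w\<in>Poly_Mapping.keys f.
      (Poly_Mapping.lookup f w \<cdot>\<^sub>m word_eval n x w) $$ ij)"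
    unfolding nc_eval_def using c by (intro finsum_ring_mat) auto
  also have "\<dots> = mat n n (\<lambda>ij. \<Sum>w\<in>Poly_Mapping.keys f.
      Poly_Mapping.lookup f w * word_eval n x w $$ ij)"
    using carrier_matD[OF c] by (intro eq_matI) auto
  also have "\<dots> = mat n n (\<lambda>ij. \<Sum>w\<in>K. Poly_Mapping.lookup f w * word_eval n x w $$ ij)"
  proof -
    have "(\<Sum>w\<in>Poly_Mapping.keys f. Poly_Mapping.lookup f w * word_eval n x w $$ ij)
        = (\<Sum>w\<in>K. Poly_Mapping.lookup f w * word_eval n x w $$ ij)" for ij
      using K by (intro sum.mono_neutral_left) (auto simp: in_keys_iff)
    then show ?thesis by simp
  qed
  finally show ?thesis .
qed

lemma nc_eval_closed:
  assumes "\<And>i. x i \<in> carrier_mat n n"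
  shows "nc_eval n x f \<in> carrier_mat n n"
  using nc_eval_superset[of x n "Poly_Mapping.keys f" f] assms by simp

lemma nc_eval_single:
  assumes x: "\<And>i. x i \<in> carrier_mat n n"
  shows "nc_eval n x (Poly_Mapping.single w c) = c \<cdot>\<^sub>m word_eval n x w"
  using nc_eval_superset[of x n "{w}" "Poly_Mapping.single w c"] x
    carrier_matD[OF word_eval_closed[of x n w]]
  by (intro eq_matI) auto

lemma nc_eval_var:
  assumes x: "\<And>i. x i \<in> carrier_mat n n"
  shows "nc_eval n x (nc_var i) = x i"
  using right_mult_one_mat[OF x[of i]] carrier_matD[OF x[of i]]
  by (auto simp: nc_var_def nc_eval_single[OF x] word_eval_def intro!: eq_matI)

lemma nc_eval_one:
  assumes x: "\<And>i. x i \<in> carrier_mat n n"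
  shows "nc_eval n x (1 :: 'a::comm_ring_1 free_algebra) = 1\<^sub>m n"
proof -
  have "nc_eval n x (1 :: 'a free_algebra) = nc_eval n x (Poly_Mapping.single 0 1)"
    by simp
  also have "\<dots> = 1\<^sub>m n"
    unfolding nc_eval_single[OF x] word_eval_zero by (intro eq_matI) auto
  finally show ?thesis .
qed

lemma nc_eval_add:
  assumes x: "\<And>i. x i \<in> carrier_mat n n"
  shows "nc_eval n x (f + g) = nc_eval n x f + nc_eval n x g"
proof -
  let ?K = "Poly_Mapping.keys f \<union> Poly_Mapping.keys g"
  have "nc_eval n x h = mat n n (\<lambda>ij. \<Sum>w\<in>?K. Poly_Mapping.lookup h w * word_eval n x w $$ ij)"
    if "Poly_Mapping.keys h \<subseteq> ?K" for h
    using that x by (intro nc_eval_superset) auto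
  from this[of f] this[of g] this[of "f + g"] keys_add[of f g] show ?thesis
    by (intro eq_matI) (auto simp: lookup_add distrib_right sum.distrib)
qed

lemma free_algebra_induct [case_names single add]:
  fixes f :: "'a::ring_1 free_algebra"
  assumes single: "\<And>w c. P (Poly_Mapping.single w c)"
    and add: "\<And>f g. P f \<Longrightarrow> P g \<Longrightarrow> P (f + g)"
  shows "P f"
proof (induction f rule: update_induct)
  case const
  show ?case using single[of 0 0] by simp
next
  case (update f w c)
  have "Poly_Mapping.update w c f = Poly_Mapping.single w c + f"
    using update(1)
    by (intro poly_mapping_eqI) (auto simp: lookup_update lookup_add lookup_single in_keys_iff when_def)
  then show ?case using add[OF single update(3)] by simp
qed

lemma nc_eval_mult:
  assumes x: "\<And>i. x i \<in> carrier_mat n n"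
  shows "nc_eval n x (f * g) = nc_eval n x f * nc_eval n x g"
proof -
  note c = nc_eval_closed[of x n, OF x] and wc = word_eval_closed[of x n, OF x]
  have left_single: "nc_eval n x (Poly_Mapping.single v a * g)
      = nc_eval n x (Poly_Mapping.single v a) * nc_eval n x g" for v a
  proof (induction g rule: free_algebra_induct)
    case (single w b)
    show ?case
      using mult_smult_assoc_mat[OF wc[of v] smult_carrier_mat[OF wc[of w], of b], of a]
        mult_smult_distrib[OF wc[of v] wc[of w], of b]
        carrier_matD[OF mult_carrier_mat[OF wc[of v] wc[of w]]]
      by (auto simp: nc_eval_single[OF x] word_eval_plus[OF x] mult_single intro!: eq_matI)
  next
    case (add g h)
    then show ?case
      using mult_add_distrib_mat[OF c c c] by (simp add: distrib_left nc_eval_add[OF x])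
  qed
  show ?thesis
  proof (induction f rule: free_algebra_induct)
    case (single v a)
    show ?case by (rule left_single)
  next
    case (add f h)
    then show ?case
      using add_mult_distrib_mat[OF c c c] by (simp add: distrib_right nc_eval_add[OF x])
  qed
qed

end

theory Submission
  imports Defs
    "Jordan_Normal_Form.Char_Poly" "Jordan_Normal_Form.Jordan_Normal_Form_Existence"
begin

text \<open>
  Expand the matrices of an assignment with noncentral value \<open>f(a)\<close> in the basis \<open>C\<^sup>p S\<^sup>q\<close> of products of
  clock and shift matrices, and multiply the coefficient of \<open>C\<^sup>p S\<^sup>q\<close> by \<open>s\<^sup>p t\<^sup>q\<close>. The value of \<open>f\<close> becomes
  a sum of terms \<open>c s\<^sup>p t\<^sup>q C\<^sup>p S\<^sup>q\<close>. Up to a scalar matrix, its lowest term for a suitable monomial order has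
  \<open>C\<^sup>p S\<^sup>q\<close> nonscalar; the spectrum of that matrix is invariant under a nontrivial rotation, so none
  of its eigenvalues has multiplicity above \<open>n/2\<close>. This bound is an open condition, hence it holds for
  the value of \<open>f\<close> at generic \<open>s, t\<close>. A matrix \<open>W\<close> satisfying it is similar to an upper triangular
  one whose first and last \<open>r \<le> n/2\<close> diagonal entries are pairwise different, and a conjugation by
  a unipotent matrix changes this triangular matrix by a square-zero matrix of rank \<open>r\<close>.
\<close>

section \<open>Roots of unity and multiplicities of roots\<close>

text \<open>Write \<open>n = p * m\<close> with \<open>p\<close> prime. If \<open>p\<close> divides
  \<open>m\<close>, a \<open>p\<close>-th root of a primitive \<open>m\<close>-th root works.
  Otherwise multiply the latter by a root of 1 + X + ... + X^(p-1); that root is not 1 in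
  characteristic 0, so it has order \<open>p\<close>.\<close>

lemma ex_primitive_root_of_unity:
  assumes "n > 0"
  shows "\<exists>z::'a::{alg_closed_field, field_char_0}. \<forall>k. z ^ k = 1 \<longleftrightarrow> n dvd k"
  using assms
proof (induction n rule: less_induct)
  case (less n)
  show ?case
  proof (cases "n = 1")
    case True
    then show ?thesis by (intro exI[of _ 1]) simp
  next
    case False
    then obtain p where p: "prime p" "p dvd n"
      using prime_factor_nat by blast
    then obtain m where n: "n = p * m" by (auto elim: dvdE)
    have p1: "p > 1" using p(1) prime_gt_1_nat by blast
    have m: "m > 0" "m < n" using less.prems p1 by (auto simp: n)
    obtain z :: 'a where z: "\<And>k. z ^ k = 1 \<longleftrightarrow> m dvd k"
      using less.IH[OF m(2,1)] by blast
    show ?thesis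
    proof (cases "p dvd m")
      case True
      obtain w where w: "w ^ p = z" using nth_root_exists[of p z] p1 by auto
      have "w ^ k = 1 \<longleftrightarrow> n dvd k" for k
      proof
        assume k: "w ^ k = 1"
        have "z ^ k = (w ^ k) ^ p" by (simp add: w[symmetric] power_mult[symmetric] mult.commute)
        then have "m dvd k" using k z by simp
        \<comment> \<open>\<open>p\<close> divides \<open>m\<close> and hence \<open>k\<close>, so
          \<open>w ^ k\<close> is a power of \<open>z\<close>.\<close>
        then obtain l where l: "k = p * l" using True by (meson dvd_trans dvdE)
        have "z ^ l = w ^ k" by (simp add: w[symmetric] power_mult[symmetric] l)
        then show "n dvd k" using z k by (simp add: n l)
      next
        assume "n dvd k"
        then obtain l where "k = p * (m * l)" by (metis n dvdE mult.assoc)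
        then have "w ^ k = z ^ (m * l)" by (simp add: power_mult w)
        then show "w ^ k = 1" using z by simp
      qed
      then show ?thesis by blast
    next
      case False
      have cop: "coprime m p" using False p(1) prime_imp_coprime_nat coprime_commute by blast
      obtain x :: 'a where x: "(\<Sum>k\<le>p - 1. 1 * x ^ k) = 0"
        using alg_closed[of "p - 1" "\<lambda>_. 1 :: 'a"] p1 by auto
      have "{..p - 1} = {..<p}" using p1 by auto
      then have x0: "(\<Sum>k<p. x ^ k) = 0" using x by simp
      have xp: "x ^ p = 1" using power_diff_1_eq[of x p] x0 by simp
      have x1: "x \<noteq> 1" using x0 p1 by auto
      have xk: "p dvd k" if "x ^ k = 1" for k
      proof (rule ccontr)
        assume "\<not> p dvd k"
        then have "coprime k p" using p(1) prime_imp_coprime_nat coprime_commute by blast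
        moreover have "k \<noteq> 0" using \<open>\<not> p dvd k\<close> by (intro notI) simp
        ultimately obtain a b where "k * a = p * b + 1"
          by (metis bezout_nat coprime_iff_gcd_eq_1)
        then have "(x ^ k) ^ a = (x ^ p) ^ b * x" by (simp flip: power_mult)
        then show False using that xp x1 by simp
      qed
      have "(x * z) ^ k = 1 \<longleftrightarrow> n dvd k" for k
      proof
        assume k: "(x * z) ^ k = 1"
        have "z ^ (k * p) = (x ^ p) ^ k * z ^ (k * p)" by (simp add: xp)
        also have "\<dots> = ((x * z) ^ k) ^ p"
          by (simp add: power_mult[symmetric] power_mult_distrib mult.commute)
        finally have "m dvd k * p" using k z by simp
        then have "m dvd k" using cop by (simp add: coprime_dvd_mult_left_iff)
        moreover have "p dvd k"
        proof (rule xk)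
          show "x ^ k = 1" using k z[of k] \<open>m dvd k\<close> by (simp add: power_mult_distrib)
        qed
        ultimately show "n dvd k" using cop by (simp add: n divides_mult mult.commute)
      next
        assume "n dvd k"
        then obtain l where "k = p * m * l" by (auto simp: n elim!: dvdE)
        then show "(x * z) ^ k = 1"
          using z[of k] xp by (simp add: power_mult_distrib power_mult)
      qed
      then show ?thesis by blast
    qed
  qed
qed

text \<open>In characteristic 0 differentiation lowers the order of a root by exactly one. A bound
  on a multiplicity thus becomes the nonvanishing of some derivative.\<close>

lemma order_le_iff_higher_pderiv:
  fixes p :: "'a::field_char_0 poly"
  assumes "p \<noteq> 0"
  shows "order x p \<le> m \<longleftrightarrow> (\<exists>i\<le>m. poly ((pderiv ^^ i) p) x \<noteq> 0)"
  using assms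
proof (induction m arbitrary: p)
  case 0
  then show ?case by (auto simp: order_root)
next
  case (Suc m)
  have split: "(\<exists>i\<le>Suc m. poly ((pderiv ^^ i) p) x \<noteq> 0) \<longleftrightarrow>
    poly p x \<noteq> 0 \<or> (\<exists>i\<le>m. poly ((pderiv ^^ i) (pderiv p)) x \<noteq> 0)"
  proof -
    have "(\<exists>i\<le>Suc m. Q i) \<longleftrightarrow> Q 0 \<or> (\<exists>i\<le>m. Q (Suc i))" for Q
      by (metis Suc_le_mono le0 not0_implies_Suc)
    from this[of "\<lambda>i. poly ((pderiv ^^ i) p) x \<noteq> 0"] show ?thesis
      by (simp add: funpow_swap1)
  qed
  show ?case
  proof (cases "poly p x = 0")
    case False
    then show ?thesis using split by (auto simp: order_root)
  next
    case True
    then have "order x p = Suc (order x (pderiv p))" using Suc.prems by (intro order_pderiv)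
    moreover have d: "pderiv p \<noteq> 0"
    proof
      assume "pderiv p = 0"
      then obtain c where "p = [:c:]" by (metis pderiv_eq_0_iff degree_eq_zeroE)
      then show False using True Suc.prems by simp
    qed
    ultimately show ?thesis using Suc.IH[OF d] split True by simp
  qed
qed

section \<open>Semicontinuity of eigenvalue multiplicities\<close>

text \<open>Horner evaluation of \<open>p\<close> at \<open>A\<close>, over any commutative ring so
  that it also applies to matrices over a polynomial ring.\<close>

definition poly_mat :: "nat \<Rightarrow> 'a::comm_ring_1 poly \<Rightarrow> 'a mat \<Rightarrow> 'a mat" where
  "poly_mat n p A = fold_coeffs (\<lambda>a M. a \<cdot>\<^sub>m 1\<^sub>m n + A * M) p (0\<^sub>m n n)"

lemma poly_mat_0 [simp]: "poly_mat n 0 A = 0\<^sub>m n n"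
  by (simp add: poly_mat_def)

lemma poly_mat_pCons:
  assumes "A \<in> carrier_mat n n"
  shows "poly_mat n (pCons a p) A = a \<cdot>\<^sub>m 1\<^sub>m n + A * poly_mat n p A"
proof (cases "a = 0 \<and> p = 0")
  case True
  then show ?thesis using assms by (auto intro!: eq_matI)
next
  case False
  then show ?thesis by (auto simp: poly_mat_def)
qed

lemma poly_mat_closed [simp]:
  assumes "A \<in> carrier_mat n n"
  shows "poly_mat n p A \<in> carrier_mat n n"
  by (induction p rule: pCons_induct) (use assms in \<open>auto simp: poly_mat_pCons\<close>)

lemma dim_poly_mat [simp]:
  assumes "A \<in> carrier_mat n n"
  shows "dim_row (poly_mat n p A) = n" "dim_col (poly_mat n p A) = n"
  using poly_mat_closed[OF assms, of p] by auto

text \<open>With \<open>h\<close> the evaluation of a parameter, it shows that the determinants of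
  the specialised matrices are the values of one polynomial in that parameter.\<close>

lemma poly_mat_hom:
  assumes "comm_ring_hom h" and A: "A \<in> carrier_mat n n"
  shows "map_mat h (poly_mat n p A) = poly_mat n (map_poly h p) (map_mat h A)"
proof -
  interpret comm_ring_hom h by fact
  have hA: "map_mat h A \<in> carrier_mat n n" using A by simp
  show ?thesis
  proof (induction p rule: pCons_induct)
    case 0
    show ?case by (auto intro!: eq_matI)
  next
    case (pCons a p)
    have c: "a \<cdot>\<^sub>m 1\<^sub>m n \<in> carrier_mat n n" "A * poly_mat n p A \<in> carrier_mat n n"
      using A by auto
    have "map_mat h (poly_mat n (pCons a p) A)
        = map_mat h (a \<cdot>\<^sub>m 1\<^sub>m n) + map_mat h (A * poly_mat n p A)"
      unfolding poly_mat_pCons[OF A] using c A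
      by (intro eq_matI) (auto simp: hom_add simp del: index_mult_mat(1))
    also have "map_mat h (A * poly_mat n p A) = map_mat h A * map_mat h (poly_mat n p A)"
      by (rule mat_hom_mult[OF A poly_mat_closed[OF A]])
    also have "map_mat h (a \<cdot>\<^sub>m 1\<^sub>m n) = h a \<cdot>\<^sub>m 1\<^sub>m n"
      by (intro eq_matI) (auto simp: hom_mult)
    finally show ?case
      by (simp add: map_poly_pCons_hom poly_mat_pCons[OF hA] pCons.IH)
  qed
qed

lemma poly_mat_eigenvector:
  fixes A :: "'a::field mat"
  assumes A: "A \<in> carrier_mat n n" and v: "v \<in> carrier_vec n" and ev: "A *\<^sub>v v = x \<cdot>\<^sub>v v"
  shows "poly_mat n p A *\<^sub>v v = poly p x \<cdot>\<^sub>v v"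
proof (induction p rule: pCons_induct)
  case 0
  show ?case using v by (auto intro!: eq_vecI)
next
  case (pCons a p)
  have "poly_mat n (pCons a p) A *\<^sub>v v = a \<cdot>\<^sub>v v + A *\<^sub>v (poly_mat n p A *\<^sub>v v)"
    using A v by (subst poly_mat_pCons[OF A], subst add_mult_distrib_mat_vec[of _ n n])
      (auto simp: assoc_mult_mat_vec[of _ n n _ n] intro!: eq_vecI)
  also have "\<dots> = a \<cdot>\<^sub>v v + poly p x \<cdot>\<^sub>v (x \<cdot>\<^sub>v v)"
    unfolding pCons.IH using A v by (simp add: mult_mat_vec ev)
  also have "\<dots> = poly (pCons a p) x \<cdot>\<^sub>v v"
    using v by (intro eq_vecI) (auto simp: algebra_simps)
  finally show ?case .
qed

lemma poly_mat_smult: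
  assumes A: "A \<in> carrier_mat n n"
  shows "poly_mat n (Polynomial.smult c p) A = c \<cdot>\<^sub>m poly_mat n p A"
proof (induction p rule: pCons_induct)
  case 0
  show ?case by (auto intro!: eq_matI)
next
  case (pCons a p)
  then show ?case using A
    by (simp add: poly_mat_pCons mult_smult_distrib[OF A poly_mat_closed[OF A]])
      (intro eq_matI, auto simp: algebra_simps simp del: index_mult_mat(1))
qed

lemma poly_mat_add:
  assumes A: "A \<in> carrier_mat n n"
  shows "poly_mat n (p + q) A = poly_mat n p A + poly_mat n q A"
proof (induction p q rule: poly_induct2)
  case 0
  show ?case by (auto intro!: eq_matI)
next
  case (pCons a p b q)
  have "A * (poly_mat n p A + poly_mat n q A) = A * poly_mat n p A + A * poly_mat n q A"
    using A by (intro mult_add_distrib_mat[of _ n n _ n]) auto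
  then show ?case using A pCons
    by (intro eq_matI) (auto simp: poly_mat_pCons algebra_simps simp del: index_mult_mat(1))
qed

lemma poly_mat_linear_mult:
  assumes A: "A \<in> carrier_mat n n"
  shows "poly_mat n ([:- x, 1:] * p) A = (A + (- x) \<cdot>\<^sub>m 1\<^sub>m n) * poly_mat n p A"
proof -
  have "[:- x, 1:] * p = Polynomial.smult (- x) p + pCons 0 p" by simp
  then have "poly_mat n ([:- x, 1:] * p) A = (- x) \<cdot>\<^sub>m poly_mat n p A + (0 \<cdot>\<^sub>m 1\<^sub>m n + A * poly_mat n p A)"
    by (simp only: poly_mat_add[OF A] poly_mat_smult[OF A] poly_mat_pCons[OF A])
  also have "\<dots> = A * poly_mat n p A + (- x) \<cdot>\<^sub>m (1\<^sub>m n * poly_mat n p A)"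
    using A poly_mat_closed[OF A, of p] left_mult_one_mat[OF poly_mat_closed[OF A, of p]]
    by (intro eq_matI) (auto simp del: index_mult_mat(1))
  also have "\<dots> = (A + (- x) \<cdot>\<^sub>m 1\<^sub>m n) * poly_mat n p A"
    using A by (subst add_mult_distrib_mat[of _ n n]) (auto simp: mult_smult_assoc_mat[of _ n n])
  finally show ?thesis .
qed

text \<open>Over an algebraically closed field \<open>p\<close> splits into linear factors, and
  \<open>A - x\<close> is singular only for eigenvalues \<open>x\<close>, so every factor
  contributes a nonzero determinant.\<close>

lemma det_poly_mat_nonzero:
  fixes A :: "'a::alg_closed_field mat"
  assumes A: "A \<in> carrier_mat n n" and "p \<noteq> 0"
    and "\<And>x. poly (char_poly A) x = 0 \<Longrightarrow> poly p x \<noteq> 0"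
  shows "det (poly_mat n p A) \<noteq> 0"
  using assms(2,3)
proof (induction "degree p" arbitrary: p)
  case 0
  then obtain c where c: "p = [:c:]" "c \<noteq> 0" by (metis degree_eq_zeroE pCons_0_0)
  have "poly_mat n p A = c \<cdot>\<^sub>m 1\<^sub>m n"
    using A by (auto simp: c poly_mat_pCons intro!: eq_matI)
  then show ?case using c by (simp add: det_smult)
next
  case (Suc d)
  then obtain x where x: "poly p x = 0"
    using alg_closed_imp_poly_has_root[of p] by auto
  then obtain q where q: "p = [:- x, 1:] * q" by (metis poly_eq_0_iff_dvd dvdE)
  have q0: "q \<noteq> 0" using Suc.prems q by auto
  then have "degree p = Suc (degree q)" by (simp add: q degree_mult_eq del: mult_pCons_left)
  then have "det (poly_mat n q A) \<noteq> 0"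
    using Suc q0 by (intro Suc.hyps) (auto simp: q simp del: mult_pCons_left)
  moreover have "det (A + (- x) \<cdot>\<^sub>m 1\<^sub>m n) \<noteq> 0"
  proof -
    have "\<not> eigenvalue A x"
      using Suc.prems(2)[of x] x eigenvalue_root_char_poly[OF A] by auto
    then show ?thesis using A by (simp add: eigenvalue_det[OF A] char_matrix_def)
  qed
  ultimately show ?case using A
    by (simp add: q poly_mat_linear_mult det_mult[of _ n] del: mult_pCons_left)
qed

text \<open>A multiple root of the characteristic polynomial is a common root of its derivatives, hence of
  a combination \<open>h\<close> of them; \<open>h\<close> evaluated at the matrix is then singular, and its determinant is a
  polynomial in the parameter.\<close>

lemma finite_large_order_specialisations:
  fixes A :: "'a::{alg_closed_field, field_char_0} poly mat"
  defines "ev \<equiv> \<lambda>t. map_mat (\<lambda>q. poly q t) A"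
  assumes A: "A \<in> carrier_mat n n"
    and t0: "\<And>x. order x (char_poly (ev t0)) \<le> m"
  shows "finite {t. \<exists>x. order x (char_poly (ev t)) > m}"
proof -
  have hom: "comm_ring_hom (\<lambda>q. poly q t)" for t :: 'a
    by unfold_locales auto
  have evc [simp]: "ev t \<in> carrier_mat n n" for t using A by (simp add: ev_def)
  have cpev: "char_poly (ev t) = map_poly (\<lambda>q. poly q t) (char_poly A)" for t
    unfolding ev_def by (rule comm_ring_hom.char_poly_hom[OF hom A])
  have cp0: "char_poly (ev t) \<noteq> 0" for t
    using degree_monic_char_poly[OF evc[of t]] by auto
  define R where "R = {x. poly (char_poly (ev t0)) x = 0}"
  have finR: "finite R" unfolding R_def by (rule poly_roots_finite[OF cp0])
  \<comment> \<open>The combination of derivatives at \<open>x\<close>, as a polynomial in an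
    unknown weight \<open>c\<close>. It is nonzero for every \<open>x\<close> because the order is
    at most \<open>m\<close>, so one \<open>c\<close> serves all the finitely many eigenvalues of
    \<open>ev t0\<close>.\<close>
  define Q where "Q x = (\<Sum>i\<le>m. monom (poly ((pderiv ^^ i) (char_poly (ev t0))) x) i)" for x
  have Q0: "Q x \<noteq> 0" for x
  proof -
    obtain i where i: "i \<le> m" "poly ((pderiv ^^ i) (char_poly (ev t0))) x \<noteq> 0"
      using t0[of x] order_le_iff_higher_pderiv[OF cp0] by blast
    have "coeff (Q x) i = poly ((pderiv ^^ i) (char_poly (ev t0))) x"
      using i(1) by (simp add: Q_def coeff_sum)
    then show ?thesis using i(2) by auto
  qed
  have "finite (\<Union>x\<in>R. {c. poly (Q x) c = 0})"
    using finR Q0 by (auto intro!: poly_roots_finite)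
  then obtain c where c: "\<And>x. x \<in> R \<Longrightarrow> poly (Q x) c \<noteq> 0"
    using ex_new_if_finite[OF infinite_UNIV_char_0] by (metis (mono_tags, lifting) UN_I mem_Collect_eq)
  \<comment> \<open>The weight \<open>[:c:]\<close> is constant in the parameter, so
    \<open>h\<close> specialises at each \<open>t\<close> to the same combination for
    \<open>char_poly (ev t)\<close>.\<close>
  define h where "h = (\<Sum>i\<le>m. Polynomial.smult ([:c:] ^ i) ((pderiv ^^ i) (char_poly A)))"
  have pd: "map_poly (\<lambda>q. poly q t) ((pderiv ^^ i) p) = (pderiv ^^ i) (map_poly (\<lambda>q. poly q t) p)" for t i and p :: "'a poly poly"
  proof (induction i)
    case (Suc i)
    have "map_poly (\<lambda>q. poly q t) (pderiv r) = pderiv (map_poly (\<lambda>q. poly q t) r)" for r :: "'a poly poly"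
      by (intro poly_eqI) (simp add: coeff_map_poly coeff_pderiv)
    then show ?case using Suc by simp
  qed simp
  have hev: "poly (map_poly (\<lambda>q. poly q t) h) x
      = (\<Sum>i\<le>m. c ^ i * poly ((pderiv ^^ i) (char_poly (ev t))) x)" for t x
  proof -
    interpret comm_ring_hom "\<lambda>q. poly q t" by (rule hom)
    interpret mp: map_poly_comm_ring_hom "\<lambda>q. poly q t" ..
    have "map_poly (\<lambda>q. poly q t) h = (\<Sum>i\<le>m. Polynomial.smult (c ^ i) ((pderiv ^^ i) (char_poly (ev t))))"
      unfolding h_def mp.hom_sum cpev pd[symmetric]
      by (intro sum.cong refl poly_eqI) (simp add: coeff_map_poly hom_mult poly_power)
    then show ?thesis by (simp add: poly_sum)
  qed
  have h0: "poly (map_poly (\<lambda>q. poly q t0) h) x \<noteq> 0" if "poly (char_poly (ev t0)) x = 0" for x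
    using c[of x] that by (simp add: hev Q_def R_def poly_sum poly_monom mult.commute)
  \<comment> \<open>\<open>D\<close> is nonzero at \<open>t0\<close>, where \<open>h\<close>
    vanishes at no eigenvalue, and it vanishes at every \<open>t\<close> with a root of order above
    \<open>m\<close>.\<close>
  define D where "D = det (poly_mat n h A)"
  have D: "poly D t = det (poly_mat n (map_poly (\<lambda>q. poly q t) h) (ev t))" for t
  proof -
    interpret comm_ring_hom "\<lambda>q. poly q t" by (rule hom)
    show ?thesis unfolding D_def ev_def poly_mat_hom[OF hom A, symmetric] by (rule comm_ring_hom.hom_det[OF hom, symmetric])
  qed
  have "poly D t0 \<noteq> 0"
  proof (cases "n = 0")
    case True
    then have "det (poly_mat n (map_poly (\<lambda>q. poly q t0) h) (ev t0)) = 1"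
      using poly_mat_closed[OF evc] by (metis det_dim_zero)
    then show ?thesis by (simp add: D)
  next
    case False
    \<comment> \<open>An eigenvalue exists once \<open>n > 0\<close>; nonvanishing there shows that
      the specialised \<open>h\<close> is not the zero polynomial.\<close>
    have "degree (char_poly (ev t0)) > 0" using degree_monic_char_poly[OF evc[of t0]] False by simp
    then obtain x where "poly (char_poly (ev t0)) x = 0" using alg_closed_imp_poly_has_root by blast
    then have "map_poly (\<lambda>q. poly q t0) h \<noteq> 0" using h0 by force
    then show ?thesis unfolding D using h0 by (intro det_poly_mat_nonzero) auto
  qed
  then have "D \<noteq> 0" by auto
  then have "finite {t. poly D t = 0}" by (rule poly_roots_finite)
  moreover have "poly D t = 0" if x: "order x (char_poly (ev t)) > m" for t x
  proof -
    have z: "poly ((pderiv ^^ i) (char_poly (ev t))) x = 0" if "i \<le> m" for i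
      using order_le_iff_higher_pderiv[OF cp0, of x t m] x that by (meson not_le)
    then have "poly (char_poly (ev t)) x = 0" using z[of 0] by simp
    then obtain v where v: "eigenvector (ev t) v x"
      using eigenvalue_root_char_poly[OF evc] by (auto simp: eigenvalue_def)
    then have v': "v \<in> carrier_vec n" "v \<noteq> 0\<^sub>v n" "ev t *\<^sub>v v = x \<cdot>\<^sub>v v"
      using evc[of t] by (auto simp: eigenvector_def)
    have "poly_mat n (map_poly (\<lambda>q. poly q t) h) (ev t) *\<^sub>v v = 0\<^sub>v n"
      using v'(1) by (simp add: poly_mat_eigenvector[OF evc v'(1,3)] hev z) (auto intro!: eq_vecI)
    then show ?thesis unfolding D
      using v' det_0_iff_vec_prod_zero[OF poly_mat_closed[OF evc]] by blast
  qed
  ultimately show ?thesis by (elim finite_subset[rotated]) auto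
qed

section \<open>Square-zero matrices as differences of conjugates\<close>

lemma index_mult_mat_sum:
  assumes "A \<in> carrier_mat nr n" "B \<in> carrier_mat n nc" "i < nr" "j < nc"
  shows "(A * B) $$ (i, j) = (\<Sum>k\<in>{0..<n}. A $$ (i, k) * B $$ (k, j))"
  using assms by (simp add: scalar_prod_def)

lemma smult_smult_mat: "a \<cdot>\<^sub>m (b \<cdot>\<^sub>m A) = (a * b :: 'a::semigroup_mult) \<cdot>\<^sub>m A"
  by (intro eq_matI) (auto simp: mult.assoc)

lemma conjugate_mult:
  fixes P :: "'a::comm_ring_1 mat"
  assumes PQ: "P \<in> carrier_mat n n" "Q \<in> carrier_mat n n" "Q * P = 1\<^sub>m n"
    and MN: "M \<in> carrier_mat n n" "N \<in> carrier_mat n n"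
  shows "P * M * Q * (P * N * Q) = P * (M * N) * Q"
proof -
  have "P * M * Q * (P * N * Q) = P * M * (Q * P) * (N * Q)"
    using MN PQ(1,2) by (simp add: assoc_mult_mat[of _ n n _ n _ n])
  then show ?thesis using MN PQ by (simp add: assoc_mult_mat[of _ n n _ n _ n])
qed

section \<open>Triangularisation with a prescribed diagonal\<close>

text \<open>Take the permutation matrix swapping 0 and \<open>k\<close>, where \<open>v $ k\<close>
  is nonzero, and replace its first column by \<open>v\<close>. For a kernel vector, row
  \<open>k\<close> kills the entry 0 and the remaining rows then kill the others.\<close>

lemma ex_invertible_first_col:
  fixes v :: "'a::field vec"
  assumes v: "v \<in> carrier_vec n" "v \<noteq> 0\<^sub>v n"
  obtains P Q where "P \<in> carrier_mat n n" "Q \<in> carrier_mat n n"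
    "P * Q = 1\<^sub>m n" "Q * P = 1\<^sub>m n" "col P 0 = v"
proof -
  obtain k where k: "k < n" "v $ k \<noteq> 0"
    using v by (metis eq_vecI carrier_vecD index_zero_vec)
  define \<tau> where "\<tau> = Transposition.transpose 0 k"
  have \<tau>: "\<tau> (\<tau> i) = i" "\<tau> 0 = k" "\<tau> k = 0" "i < n \<Longrightarrow> \<tau> i < n" for i
    using k by (auto simp: \<tau>_def Transposition.transpose_def)
  define P where "P = mat n n (\<lambda>(i, j). if j = 0 then v $ i else if i = \<tau> j then 1 else 0)"
  have P: "P \<in> carrier_mat n n" by (simp add: P_def)
  have "det P \<noteq> 0"
  proof
    assume "det P = 0"
    then obtain w where w: "w \<in> carrier_vec n" "w \<noteq> 0\<^sub>v n" "P *\<^sub>v w = 0\<^sub>v n"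
      using det_0_iff_vec_prod_zero[OF P] by blast
    have row: "v $ i * w $ 0 + (if \<tau> i = 0 then 0 else w $ \<tau> i) = 0" if i: "i < n" for i
    proof -
      have "0 = (P *\<^sub>v w) $ i" using w i by simp
      also have "\<dots> = (\<Sum>j\<in>{0..<n}. P $$ (i, j) * w $ j)"
        using w(1) i P by (simp add: scalar_prod_def)
      also have "\<dots> = (\<Sum>j\<in>{0..<n}. (if j = 0 then v $ i * w $ 0 else 0)
          + (if j = \<tau> i then if \<tau> i = 0 then 0 else w $ \<tau> i else 0))"
        using i \<tau>(1) by (intro sum.cong) (auto simp: P_def)
      also have "\<dots> = v $ i * w $ 0 + (if \<tau> i = 0 then 0 else w $ \<tau> i)"
        using k(1) \<tau>(4)[OF i] by (simp add: sum.distrib)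
      finally show ?thesis by simp
    qed
    have w0: "w $ 0 = 0" using row[OF k(1)] k(2) \<tau>(3) by simp
    have "w $ j = 0" if "j < n" for j
    proof (cases "j = 0")
      case False
      then show ?thesis using row[OF \<tau>(4)[OF that]] \<tau>(1)[of j] w0 by simp
    qed (simp add: w0)
    then show False using w by (metis eq_vecI carrier_vecD index_zero_vec)
  qed
  then obtain Q where Q: "Q \<in> carrier_mat n n" "P * Q = 1\<^sub>m n" "Q * P = 1\<^sub>m n"
    using det_non_zero_imp_unit[OF P] by (auto simp: Units_def ring_mat_simps)
  have "col P 0 = v" using k(1) v(1) by (intro eq_vecI) (auto simp: P_def)
  then show ?thesis using that P Q by blast
qed

text \<open>An eigenvector for the first root, taken as first basis vector, splits off that root,
  and the induction continues in the complementary diagonal block. The free choice of the order of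
  \<open>es\<close> is what later allows equal eigenvalues to be kept apart.\<close>

lemma ex_upper_triangular_similar:
  fixes A :: "'a::field mat"
  assumes "A \<in> carrier_mat n n" and "char_poly A = (\<Prod>e\<leftarrow>es. [:- e, 1:])"
  shows "\<exists>B. similar_mat A B \<and> upper_triangular B \<and> diag_mat B = es"
  using assms
proof (induction es arbitrary: n A)
  case Nil
  then have "n = 0" using degree_monic_char_poly[of A n] by simp
  then show ?case using Nil
    by (intro exI[of _ A]) (auto simp: diag_mat_def intro: similar_mat_refl)
next
  case (Cons e es n A)
  note A = Cons.prems(1)
  have "eigenvalue A e"
    by (simp add: eigenvalue_root_char_poly[OF A] Cons.prems(2))
  then obtain v where v: "v \<in> carrier_vec n" "v \<noteq> 0\<^sub>v n" "A *\<^sub>v v = e \<cdot>\<^sub>v v"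
    using A by (auto simp: eigenvalue_def eigenvector_def)
  then obtain m where n: "n = Suc m" by (cases n) auto
  obtain P Q where PQ: "P \<in> carrier_mat n n" "Q \<in> carrier_mat n n"
    "P * Q = 1\<^sub>m n" "Q * P = 1\<^sub>m n" "col P 0 = v"
    using ex_invertible_first_col[OF v(1,2)] .
  define A' where "A' = Q * A * P"
  have A': "A' \<in> carrier_mat n n" using PQ A by (simp add: A'_def)
  have sim: "similar_mat A' A"
    by (rule similar_matI[of _ _ Q P n]) (use PQ A A' in \<open>auto simp: A'_def\<close>)
  have col0: "col A' 0 = e \<cdot>\<^sub>v unit_vec n 0"
  proof -
    have "col A' 0 = Q *\<^sub>v (A *\<^sub>v col P 0)"
      using PQ(1,2) A n by (simp add: A'_def col_mult2[of _ n n _ n] assoc_mult_mat_vec[of _ n n _ n])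
    also have "\<dots> = e \<cdot>\<^sub>v (Q *\<^sub>v col P 0)" using PQ v by (simp add: mult_mat_vec[of _ n n])
    also have "Q *\<^sub>v col P 0 = col (Q * P) 0"
      using PQ(1,2) n by (simp add: col_mult2[of _ n n _ n])
    also have "\<dots> = unit_vec n 0" using PQ n by simp
    finally show ?thesis .
  qed
  define A1 A2 A3 where "A1 = mat 1 1 (\<lambda>_. e)" and "A2 = mat 1 m (\<lambda>(i, j). A' $$ (0, Suc j))"
    and "A3 = mat m m (\<lambda>(i, j). A' $$ (Suc i, Suc j))"
  have c: "A1 \<in> carrier_mat 1 1" "A2 \<in> carrier_mat 1 m" "A3 \<in> carrier_mat m m"
    by (auto simp: A1_def A2_def A3_def)
  have e0: "A' $$ (i, 0) = (if i = 0 then e else 0)" if "i < n" for i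
    using arg_cong[OF col0, of "\<lambda>w. w $ i"] that A' n by auto
  have dA1: "diag_mat A1 = [e]" by (simp add: A1_def diag_mat_def)
  have blk: "A' = four_block_mat A1 A2 (0\<^sub>m m 1) A3"
    using A' e0 n c by (intro eq_matI) (auto simp: A1_def A2_def A3_def)
  have utA1: "upper_triangular A1" by (auto simp: A1_def)
  have cpA1: "char_poly A1 = [:- e, 1:]"
    by (subst char_poly_upper_triangular[OF c(1) utA1]) (simp add: dA1)
  \<comment> \<open>Cancelling the factor X - e leaves exactly the remaining roots for the block
    \<open>A3\<close>.\<close>
  have "[:- e, 1:] * char_poly A3 = [:- e, 1:] * (\<Prod>e\<leftarrow>es. [:- e, 1:])"
    using char_poly_four_block_zeros_col[OF c] char_poly_similar[OF sim] Cons.prems(2)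
    by (simp only: cpA1 blk[symmetric]) simp
  then have "char_poly A3 = (\<Prod>e\<leftarrow>es. [:- e, 1:])"
    by (subst (asm) mult_left_cancel) auto
  then obtain B3 where B3: "similar_mat A3 B3" "upper_triangular B3" "diag_mat B3 = es"
    using Cons.IH[OF c(3)] by blast
  obtain B2 where B2: "B2 \<in> carrier_mat 1 m"
    "similar_mat A' (four_block_mat A1 B2 (0\<^sub>m m 1) B3)"
    using similar_mat_four_block_0_ex[OF similar_mat_refl[OF c(1)] B3(1) c(2) c(1) c(3)] blk by auto
  have B3c: "B3 \<in> carrier_mat m m" using similar_matD[OF B3(1)] c(3) by auto
  have "upper_triangular (four_block_mat A1 B2 (0\<^sub>m m 1) B3)"
    using B3(2) B3c c(1) by (intro upper_triangular_four_block) (auto simp: A1_def)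
  moreover have "diag_mat (four_block_mat A1 B2 (0\<^sub>m m 1) B3) = e # es"
    by (subst diag_four_block_mat[OF c(1) B3c]) (simp add: B3(3) dA1)
  ultimately show ?case
    using similar_mat_trans[OF similar_mat_sym[OF sim] B2(2)] by blast
qed

lemma char_poly_splits:
  fixes A :: "'a::alg_closed_field mat"
  assumes A: "A \<in> carrier_mat n n"
  obtains es where "char_poly A = (\<Prod>e\<leftarrow>es. [:- e, 1:])" "length es = n"
proof -
  have cp: "degree (char_poly A) = n" "coeff (char_poly A) n = 1"
    using degree_monic_char_poly[OF A] by auto
  then have "char_poly A \<noteq> 0" by auto
  then obtain M where M: "size M = n" "char_poly A = (\<Prod>x\<in>#M. [:- x, 1:])"
    using alg_closed_imp_factorization[of "char_poly A"] cp by auto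
  obtain es where "mset es = M" using ex_mset by blast
  then have "char_poly A = (\<Prod>e\<leftarrow>es. [:- e, 1:])" "length es = n"
    using M by (auto simp flip: prod_mset_prod_list)
  then show ?thesis using that by blast
qed

lemma order_prod_list_linear:
  fixes x :: "'a::field"
  shows "order x (\<Prod>e\<leftarrow>es. [:- e, 1:]) = count_list es x"
proof (induction es)
  case (Cons e es)
  have "(\<Prod>e\<leftarrow>xs. [:- e, 1:]) \<noteq> 0" for xs :: "'a list"
    by (induction xs) (simp_all del: mult_pCons_left)
  from this[of "e # es"] have "order x (\<Prod>e\<leftarrow>e # es. [:- e, 1:]) = order x [:- e, 1:] + count_list es x"
    using Cons by (simp add: order_mult del: mult_pCons_left)
  moreover have "order x [:- e, 1:] = (if e = x then 1 else 0)"
    using order_power_n_n[of x 1] by (auto simp: order_0I)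
  ultimately show ?case by simp
qed simp

text \<open>Grouping equal entries makes each value occupy an interval. Two equal entries at
  distance \<open>length xs - r\<close> would force a run of \<open>length xs - r + 1\<close> equal
  entries, more than half of the list.\<close>

lemma ex_rearrangement_separated:
  assumes "\<And>x. 2 * count_list xs x \<le> length xs" and r: "2 * r \<le> length xs"
  obtains ys where "mset ys = mset xs" "\<And>i. i < r \<Longrightarrow> ys ! i \<noteq> ys ! (length xs - r + i)"
proof -
  \<comment> \<open>The entries carry no order, so they are grouped by sorting along an injective
    numbering.\<close>
  obtain f :: "'a \<Rightarrow> nat" where f: "inj_on f (set xs)"
    using finite_imp_inj_to_nat_seg[of "set xs"] by auto
  define ys where "ys = sort_key f xs"
  have ys: "mset ys = mset xs" "set ys = set xs" "length ys = length xs" "sorted (map f ys)"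
    by (auto simp: ys_def)
  have "ys ! i \<noteq> ys ! (length xs - r + i)" if i: "i < r" for i
  proof
    assume eq: "ys ! i = ys ! (length xs - r + i)"
    have l: "length xs - r + i < length ys" using i r ys(3) by simp
    have eq_i: "ys ! j = ys ! i" if j: "i \<le> j" "j \<le> length xs - r + i" for j
    proof -
      have jl: "j < length ys" "i < length ys" using j l by linarith+
      have "f (ys ! i) \<le> f (ys ! j)"
        using sorted_nth_mono[OF ys(4) j(1)] jl by simp
      moreover have "f (ys ! j) \<le> f (ys ! i)"
        unfolding eq using sorted_nth_mono[OF ys(4) j(2)] jl l by simp
      ultimately have "f (ys ! j) = f (ys ! i)" by (rule antisym[rotated])
      then show ?thesis
        using nth_mem[OF jl(1)] nth_mem[OF jl(2)] unfolding ys(2) by (rule inj_onD[OF f])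
    qed
    have "{i..length xs - r + i} \<subseteq> {j. j < length ys \<and> ys ! j = ys ! i}"
    proof
      fix j assume "j \<in> {i..length xs - r + i}"
      then have "i \<le> j" "j \<le> length xs - r + i" by simp_all
      then show "j \<in> {j. j < length ys \<and> ys ! j = ys ! i}" using eq_i[of j] l by simp
    qed
    then have "card {i..length xs - r + i} \<le> card {j. j < length ys \<and> ys ! j = ys ! i}"
      by (intro card_mono) auto
    also have "\<dots> = length (filter (\<lambda>y. y = ys ! i) ys)"
      by (simp add: length_filter_conv_card)
    also have "\<dots> = count (mset ys) (ys ! i)"
      unfolding count_mset count_list_eq_length_filter
      by (intro arg_cong[of _ _ length] filter_cong) auto
    also have "\<dots> = count_list xs (ys ! i)"
      by (simp add: ys(1) count_mset)
    finally have "2 * (length xs - r + 1) \<le> length xs"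
      using assms(1)[of "ys ! i"] by simp
    then show False using i r by simp
  qed
  then show ?thesis using that ys(1) by blast
qed

lemma similar_mat_permute:
  fixes A :: "'a::field mat"
  assumes A: "A \<in> carrier_mat n n" and p: "bij_betw p {..<n} {..<n}"
  shows "similar_mat (mat n n (\<lambda>(i, j). A $$ (p i, p j))) A"
proof -
  define P Q :: "'a mat" where "P = mat n n (\<lambda>(i, j). if j = p i then 1 else 0)"
    and "Q = mat n n (\<lambda>(i, j). if i = p j then 1 else 0)"
  have c: "P \<in> carrier_mat n n" "Q \<in> carrier_mat n n" by (auto simp: P_def Q_def)
  have pl: "p i < n" if "i < n" for i using p that by (auto dest: bij_betwE)
  have PB: "(P * B) $$ (i, j) = B $$ (p i, j)" if "B \<in> carrier_mat n n" "i < n" "j < n" for B i j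
  proof -
    have "(P * B) $$ (i, j) = (\<Sum>k\<in>{0..<n}. (if k = p i then B $$ (k, j) else 0))"
      using that by (subst index_mult_mat_sum[OF c(1) that]) (intro sum.cong refl, auto simp: P_def)
    then show ?thesis using pl that by simp
  qed
  have BQ: "(B * Q) $$ (i, j) = B $$ (i, p j)" if "B \<in> carrier_mat n n" "i < n" "j < n" for B i j
  proof -
    have "(B * Q) $$ (i, j) = (\<Sum>k\<in>{0..<n}. (if k = p j then B $$ (i, k) else 0))"
      using that by (subst index_mult_mat_sum[OF that(1) c(2) that(2,3)]) (intro sum.cong refl, auto simp: Q_def)
    then show ?thesis using pl that by simp
  qed
  have "p i = p j \<longleftrightarrow> i = j" if "i < n" "j < n" for i j
    using p that by (auto simp: bij_betw_def inj_on_def)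
  then have PQ: "P * Q = 1\<^sub>m n"
    using c pl by (intro eq_matI) (auto simp: PB[OF c(2)] simp del: index_mult_mat(1), auto simp: Q_def)
  then have QP: "Q * P = 1\<^sub>m n" by (rule mat_mult_left_right_inverse[OF c])
  have "mat n n (\<lambda>(i, j). A $$ (p i, p j)) = P * A * Q"
    using c A pl by (intro eq_matI) (auto simp: PB BQ simp del: index_mult_mat(1))
  then show ?thesis
    by (intro similar_matI[OF _ PQ QP]) (use c A in auto)
qed

section \<open>Normal form of square-zero matrices\<close>

text \<open>An identity block of size \<open>r\<close> in the top right corner: for
  \<open>2 * r \<le> n\<close> this is the normal form of a square-zero matrix of rank
  \<open>r\<close>.\<close>

definition corner_mat :: "nat \<Rightarrow> nat \<Rightarrow> 'a::comm_ring_1 mat" where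
  "corner_mat n r = mat n n (\<lambda>(i, j). if i < r \<and> j = n - r + i then 1 else 0)"

lemma corner_mat_carrier [simp]: "corner_mat n r \<in> carrier_mat n n"
  by (simp add: corner_mat_def)

lemma corner_mat_dim [simp]: "dim_row (corner_mat n r) = n" "dim_col (corner_mat n r) = n"
  by (auto simp: corner_mat_def)

text \<open>The ones of \<open>J\<close> belong to disjoint pairs of an index in \<open>I\<close>
  and its successor. Reordering the basis so that \<open>I\<close> comes first, the successors come
  last in the same order, and all else lies between moves the ones to the corner.\<close>

lemma similar_corner_mat:
  fixes J :: "'a::field mat"
  assumes J: "J \<in> carrier_mat n n" and I: "\<And>i. i \<in> I \<Longrightarrow> Suc i < n" "I \<inter> Suc ` I = {}"
    and entries: "\<And>i j. i < n \<Longrightarrow> j < n \<Longrightarrow> J $$ (i, j) = (if j = Suc i \<and> i \<in> I then 1 else 0)"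
  obtains r where "2 * r \<le> n" "similar_mat (corner_mat n r) J"
proof -
  have fin: "finite I" by (rule finite_subset[of _ "{..<n}"]) (use I(1) in \<open>auto dest: Suc_lessD\<close>)
  define r where "r = card I"
  define K where "K = {..<n} - (I \<union> Suc ` I)"
  have sub: "I \<union> Suc ` I \<subseteq> {..<n}" using I(1) by (auto dest: Suc_lessD)
  have cSuc: "card (Suc ` I) = r" by (simp add: r_def card_image)
  have cU: "card (I \<union> Suc ` I) = 2 * r"
    using card_Un_disjoint[OF fin _ I(2)] fin cSuc by (simp add: r_def)
  then have r: "2 * r \<le> n" using card_mono[OF _ sub] by simp
  have cK: "card K = n - 2 * r" unfolding K_def using sub cU by (subst card_Diff_subset) (auto simp: fin)
  obtain f where f: "bij_betw f {0..<r} I" using ex_bij_betw_nat_finite[OF fin] r_def by auto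
  obtain g0 where g0: "bij_betw g0 {0..<n - 2 * r} K"
    using ex_bij_betw_nat_finite[of K] cK by (auto simp: K_def)
  have "bij_betw (\<lambda>i. i - r) {r..<n - r} {0..<n - 2 * r}"
    by (rule bij_betw_byWitness[of _ "\<lambda>i. i + r"]) auto
  then have g: "bij_betw (\<lambda>i. g0 (i - r)) {r..<n - r} K"
    using bij_betw_trans[OF _ g0] by (simp add: comp_def)
  have "bij_betw (\<lambda>i. i - (n - r)) {n - r..<n} {0..<r}"
    by (rule bij_betw_byWitness[of _ "\<lambda>i. i + (n - r)"]) (use r in auto)
  then have "bij_betw (\<lambda>i. f (i - (n - r))) {n - r..<n} I"
    using bij_betw_trans[OF _ f] by (simp add: comp_def)
  then have h: "bij_betw (\<lambda>i. Suc (f (i - (n - r)))) {n - r..<n} (Suc ` I)"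
    using bij_betw_trans[of _ _ I Suc "Suc ` I"] by (simp add: comp_def bij_betw_def)
  \<comment> \<open>The same enumeration \<open>f\<close> of \<open>I\<close> is used at both ends,
    so \<open>i\<close> and \<open>n - r + i\<close> are sent to the two members of one
    pair.\<close>
  define p where "p i = (if i < r then f i else if i < n - r then g0 (i - r) else Suc (f (i - (n - r))))" for i
  have p1: "bij_betw p {0..<r} I"
    using f by (subst bij_betw_cong[of _ _ f]) (auto simp: p_def)
  have p2: "bij_betw p {r..<n - r} K"
    using g by (subst bij_betw_cong[of _ _ "\<lambda>i. g0 (i - r)"]) (auto simp: p_def)
  have p3: "bij_betw p {n - r..<n} (Suc ` I)"
    using h r by (subst bij_betw_cong[of _ _ "\<lambda>i. Suc (f (i - (n - r)))"]) (auto simp: p_def)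
  have "bij_betw p (({0..<r} \<union> {r..<n - r}) \<union> {n - r..<n}) ((I \<union> K) \<union> Suc ` I)"
    using I(2) by (intro bij_betw_combine p1 p2 p3) (auto simp: K_def)
  moreover have "({0..<r} \<union> {r..<n - r}) \<union> {n - r..<n} = {..<n}" using r by auto
  moreover have "(I \<union> K) \<union> Suc ` I = {..<n}" using sub by (auto simp: K_def)
  ultimately have p: "bij_betw p {..<n} {..<n}" by simp
  have pI: "p i \<in> I \<longleftrightarrow> i < r" if "i < n" for i
  proof
    assume "p i \<in> I"
    then obtain j where "j < r" "p j = p i" using p1 by (auto simp: bij_betw_def image_iff)
    then show "i < r" using p that r by (auto simp: bij_betw_def inj_on_def)
  qed (use p1 in \<open>auto dest: bij_betwE\<close>)
  have pS: "p (n - r + i) = Suc (p i)" if "i < r" for i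
    using that r by (auto simp: p_def)
  have pinj: "p i = p j \<longleftrightarrow> i = j" if "i < n" "j < n" for i j
    using p that by (auto simp: bij_betw_def inj_on_def)
  have pl: "p i < n" if "i < n" for i using p that by (auto dest: bij_betwE)
  have "corner_mat n r = mat n n (\<lambda>(i, j). J $$ (p i, p j))"
  proof (intro eq_matI, goal_cases)
    case (1 i j)
    then have ij: "i < n" "j < n" by auto
    have "p j = Suc (p i) \<and> p i \<in> I \<longleftrightarrow> i < r \<and> j = n - r + i"
      using pI[OF ij(1)] pS[of i] pinj[of j "n - r + i"] ij r by auto
    then show ?case using ij pl entries by (simp add: corner_mat_def)
  qed auto
  then show ?thesis using that[OF r] similar_mat_permute[OF J p] by simp
qed

text \<open>The condition that the square vanishes is read off entry by entry, for which this
  bidiagonal shape is more convenient than the list of blocks.\<close>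

lemma jordan_matrix_entries:
  "\<exists>d s. (\<forall>i. s i \<in> {0, 1}) \<and> (\<forall>i < sum_list (map fst n_as). \<forall>j < sum_list (map fst n_as).
    jordan_matrix n_as $$ (i, j) = (if i = j then d i else if j = Suc i then s i else (0::'a::field)))"
proof (induction n_as)
  case Nil
  show ?case by (auto intro!: exI[of _ "\<lambda>_. 0"])
next
  case (Cons na n_as)
  obtain n a where na: "na = (n, a)" by force
  obtain d s where ds: "\<And>i. s i \<in> {0, 1 :: 'a}" "\<And>i j. i < sum_list (map fst n_as) \<Longrightarrow> j < sum_list (map fst n_as) \<Longrightarrow>
    jordan_matrix n_as $$ (i, j) = (if i = j then d i else if j = Suc i then s i else 0)"
    using Cons by blast
  show ?case
    \<comment> \<open>At the last index of the first block, where \<open>Suc i = n\<close>, the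
      superdiagonal entry is 0 because the next block starts there.\<close>
    by (rule exI[of _ "\<lambda>i. if i < n then a else d (i - n)"],
        rule exI[of _ "\<lambda>i. if Suc i < n then 1 else if i < n then 0 else s (i - n)"])
      (use ds in \<open>auto simp: na jordan_matrix_Cons Suc_diff_le\<close>)
qed

lemma similar_square_zero:
  fixes A :: "'a::comm_ring_1 mat"
  assumes "similar_mat A B" and A: "A \<in> carrier_mat n n" and "A * A = 0\<^sub>m n n"
  shows "B * B = 0\<^sub>m n n"
proof -
  obtain P Q where w: "similar_mat_wit B A P Q"
    using similar_mat_sym[OF assms(1)] by (auto simp: similar_mat_def)
  have B: "B \<in> carrier_mat n n" using similar_matD[OF assms(1)] A by auto
  note w = similar_mat_witD2[OF B w]
  have "B * B = P * (A * A) * Q"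
    using conjugate_mult[OF w(6,7,2) A A] w(3) by simp
  then show ?thesis using w assms(3) by simp
qed

text \<open>In the square of the Jordan form the diagonal holds the squared eigenvalues and the
  second superdiagonal the products of adjacent superdiagonal entries. Both vanish, so the matrix is
  nilpotent with blocks of size at most 2.\<close>

lemma square_zero_similar_corner_mat:
  fixes u :: "'a::alg_closed_field mat"
  assumes u: "u \<in> carrier_mat n n" and "u * u = 0\<^sub>m n n"
  obtains r where "2 * r \<le> n" "similar_mat u (corner_mat n r)"
proof -
  obtain es where "char_poly u = (\<Prod>e\<leftarrow>es. [:- e, 1:])" using char_poly_splits[OF u] .
  then obtain B where B: "similar_mat u B" "upper_triangular B"
    using ex_upper_triangular_similar[OF u] by blast
  have "B \<in> carrier_mat n n" using similar_matD[OF B(1)] u by auto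
  from triangular_to_jnf_vector[OF this B(2)] obtain n_as where "similar_mat B (jordan_matrix n_as)"
    unfolding jordan_nf_def by blast
  then have sim: "similar_mat u (jordan_matrix n_as)" using B(1) similar_mat_trans by blast
  define J where "J = jordan_matrix n_as"
  have J: "J \<in> carrier_mat n n" using similar_matD[OF sim] u by (auto simp: J_def)
  then have sn: "sum_list (map fst n_as) = n" by (auto simp: J_def)
  have J2: "J * J = 0\<^sub>m n n" using similar_square_zero[OF sim u assms(2)] by (simp add: J_def)
  obtain d s where s: "\<And>i. s i \<in> {0, 1}" and ent: "\<And>i j. i < n \<Longrightarrow> j < n \<Longrightarrow>
    J $$ (i, j) = (if i = j then d i else if j = Suc i then s i else 0)"
    using jordan_matrix_entries[of n_as] unfolding sn J_def[symmetric] by blast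
  have sq: "(\<Sum>k\<in>{0..<n}. J $$ (i, k) * J $$ (k, j)) = 0" if "i < n" "j < n" for i j
    using arg_cong[OF J2, of "\<lambda>M. M $$ (i, j)"] that J by (simp add: scalar_prod_def)
  have d: "d i = 0" if i: "i < n" for i
  proof -
    have "(\<Sum>k\<in>{0..<n}. J $$ (i, k) * J $$ (k, i)) = (\<Sum>k\<in>{0..<n}. if k = i then d i * d i else 0)"
      using i by (intro sum.cong) (auto simp: ent)
    then show ?thesis using sq[OF i i] i by simp
  qed
  have ss: "s i = 0 \<or> s (Suc i) = 0" if i: "Suc (Suc i) < n" for i
  proof -
    have "(\<Sum>k\<in>{0..<n}. J $$ (i, k) * J $$ (k, Suc (Suc i)))
        = (\<Sum>k\<in>{0..<n}. if k = Suc i then s i * s (Suc i) else 0)"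
      using i d by (intro sum.cong) (auto simp: ent)
    then show ?thesis using sq[of i "Suc (Suc i)"] i by simp
  qed
  define I where "I = {i. Suc i < n \<and> s i = 1}"
  obtain r where "2 * r \<le> n" "similar_mat (corner_mat n r) J"
  proof (rule similar_corner_mat[OF J, of I])
    show "I \<inter> Suc ` I = {}" using ss by (fastforce simp: I_def)
    show "J $$ (i, j) = (if j = Suc i \<and> i \<in> I then 1 else 0)" if "i < n" "j < n" for i j
      using that ent d s[of i] by (auto simp: I_def)
  qed (auto simp: I_def)
  then show ?thesis
    using that similar_mat_trans[OF sim[folded J_def]] similar_mat_sym by blast
qed

text \<open>Conjugating an upper triangular matrix \<open>T\<close> by \<open>1 + N\<close>, where \<open>N\<close> is the corner matrix, adds
  the corner block with diagonal entries \<open>T\<^sub>m\<^sub>m - T\<^sub>i\<^sub>i\<close>, \<open>m = n - r + i\<close>, which is invertible.\<close>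

lemma upper_triangular_add_corner:
  fixes T :: "'a::field mat"
  assumes T: "T \<in> carrier_mat n n" "upper_triangular T" and r: "2 * r \<le> n"
    and ne: "\<And>i. i < r \<Longrightarrow> T $$ (i, i) \<noteq> T $$ (n - r + i, n - r + i)"
  obtains T' where "similar_mat T' T" "similar_mat (corner_mat n r) (T' - T)"
proof -
  define N :: "'a mat" where "N = corner_mat n r"
  have N: "N \<in> carrier_mat n n" by (simp add: N_def)
  have NB: "(N * B) $$ (i, j) = (if i < r then B $$ (n - r + i, j) else 0)"
    if "B \<in> carrier_mat n n" "i < n" "j < n" for B i j
  proof -
    have "(N * B) $$ (i, j) = (\<Sum>k\<in>{0..<n}. if k = n - r + i then if i < r then B $$ (k, j) else 0 else 0)"
      using that by (subst index_mult_mat_sum[OF N that]) (intro sum.cong refl, auto simp: N_def corner_mat_def)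
    then show ?thesis using that r by auto
  qed
  have BN: "(B * N) $$ (i, j) = (if n - r \<le> j then B $$ (i, j - (n - r)) else 0)"
    if "B \<in> carrier_mat n n" "i < n" "j < n" for B i j
  proof -
    have "(B * N) $$ (i, j) = (\<Sum>k\<in>{0..<n}. if k = j - (n - r) then if n - r \<le> j then B $$ (i, k) else 0 else 0)"
      using that r by (subst index_mult_mat_sum[OF that(1) N that(2,3)]) (intro sum.cong refl, auto simp: N_def corner_mat_def)
    then show ?thesis using that r by auto
  qed
  have T0: "T $$ (i, j) = 0" if "j < i" "i < n" for i j using T that by auto
  have NN: "N * N = 0\<^sub>m n n"
    using N r by (intro eq_matI) (auto simp: NB simp del: index_mult_mat(1), auto simp: N_def corner_mat_def)
  have NTc: "N * T \<in> carrier_mat n n" "T * N \<in> carrier_mat n n" using N T by auto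
  \<comment> \<open>The product contains only entries of \<open>T\<close> from rows at least
    \<open>n - r\<close> and columns below \<open>r\<close>, which lie below the diagonal. Hence
    \<open>T' - T\<close> will be the commutator \<open>U\<close>.\<close>
  have NTN: "N * T * N = 0\<^sub>m n n"
    using N T(1) NTc r by (intro eq_matI) (auto simp: BN NB T0 simp del: index_mult_mat(1))
  define U where "U = N * T - T * N"
  have U: "U \<in> carrier_mat n n" using N T by (auto simp: U_def)
  have Uent: "U $$ (i, j) = (if i < r then T $$ (n - r + i, j) else 0)
      - (if n - r \<le> j then T $$ (i, j - (n - r)) else 0)" if "i < n" "j < n" for i j
    using that N T(1) by (simp add: U_def NB BN del: index_mult_mat(1))
  \<comment> \<open>\<open>U\<close> lives in the top right block of size \<open>r\<close> and is
    upper triangular there; \<open>Ud\<close> treats the diagonal of that block.\<close>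
  have U0: "U $$ (i, j) = 0" if "i < n" "j < n" "r \<le> i \<or> j < n - r + i" for i j
    using that r by (auto simp: Uent T0)
  have Ud: "U $$ (i, n - r + i) \<noteq> 0" if "i < r" for i
    using that r ne[OF that] by (simp add: Uent)
  define T' where "T' = (1\<^sub>m n + N) * T * (1\<^sub>m n - N)"
  have inv: "(1\<^sub>m n + N) * (1\<^sub>m n - N) = 1\<^sub>m n"
  proof -
    have "(1\<^sub>m n + N) * (1\<^sub>m n - N) = 1\<^sub>m n * (1\<^sub>m n - N) + N * (1\<^sub>m n - N)"
      using N by (intro add_mult_distrib_mat) auto
    also have "\<dots> = (1\<^sub>m n - N) + (N * 1\<^sub>m n - N * N)"
      using N by (simp add: mult_minus_distrib_mat[of _ n n _ n])
    also have "\<dots> = 1\<^sub>m n" using N NN by (intro eq_matI) auto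
    finally show ?thesis .
  qed
  then have inv': "(1\<^sub>m n - N) * (1\<^sub>m n + N) = 1\<^sub>m n"
    using N by (intro mat_mult_left_right_inverse[of "1\<^sub>m n + N" n]) auto
  have T': "T' \<in> carrier_mat n n" using N T by (auto simp: T'_def)
  have "similar_mat T' T"
    by (rule similar_matI[OF _ inv inv']) (use N T T' in \<open>auto simp: T'_def\<close>)
  moreover have "T' - T = U"
  proof -
    have "T' = (T + N * T) * (1\<^sub>m n - N)"
      using N T by (simp add: T'_def add_mult_distrib_mat[of _ n n])
    also have "\<dots> = (T + N * T) * 1\<^sub>m n - (T + N * T) * N"
      using N T by (intro mult_minus_distrib_mat) auto
    also have "(T + N * T) * N = T * N + N * T * N"
      using N T by (intro add_mult_distrib_mat) auto
    finally have "T' = (T + N * T) - (T * N + 0\<^sub>m n n)"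
      using N T NTN by simp
    then show ?thesis using N T NTc by (simp add: U_def) (intro eq_matI, auto simp del: index_mult_mat(1))
  qed
  moreover have "similar_mat N U"
  proof -
    \<comment> \<open>\<open>H\<close> is block diagonal, consisting of an identity and the corner
      block of \<open>U\<close>. Then \<open>N * H = U\<close> and \<open>H * U = U\<close>, so
      \<open>H\<close> conjugates \<open>U\<close> into \<open>N\<close>.\<close>
    define H where "H = mat n n (\<lambda>(i, j). if i < n - r then if i = j then 1 else 0 else U $$ (i - (n - r), j))"
    have H: "H \<in> carrier_mat n n" by (simp add: H_def)
    have "upper_triangular H" using U0 r by (auto simp: H_def)
    then have "det H = prod_list (diag_mat H)" by (rule det_upper_triangular[OF _ H])
    moreover have "0 \<notin> set (diag_mat H)"
    proof -
      have "H $$ (i, i) \<noteq> 0" if "i < n" for i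
      proof (cases "i < n - r")
        case False
        then have "n - r + (i - (n - r)) = i" "i - (n - r) < r" using that r by auto
        then show ?thesis using that False Ud[of "i - (n - r)"] by (simp add: H_def)
      qed (use that in \<open>simp add: H_def\<close>)
      then show ?thesis using H by (auto simp: diag_mat_def)
    qed
    ultimately have "det H \<noteq> 0" by (simp add: prod_list_zero_iff)
    then obtain G where G: "G \<in> carrier_mat n n" "H * G = 1\<^sub>m n" "G * H = 1\<^sub>m n"
      using det_non_zero_imp_unit[OF H] by (auto simp: Units_def ring_mat_simps)
    have NH: "N * H = U"
      using H U U0 N r by (intro eq_matI) (auto simp: NB simp del: index_mult_mat(1), auto simp: H_def)
    have HU: "H * U = U"
    proof (intro eq_matI, goal_cases)
      case (1 i j)
      then have ij: "i < n" "j < n" using U by auto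
      have "(H * U) $$ (i, j) = (\<Sum>k\<in>{0..<n}. H $$ (i, k) * U $$ (k, j))"
        using ij H U by (simp add: scalar_prod_def)
      also have "\<dots> = (\<Sum>k\<in>{0..<n}. if k = i then U $$ (i, j) else 0)"
      proof (intro sum.cong refl, goal_cases)
        case (1 k)
        show ?case
        proof (cases "i < n - r")
          case True
          then show ?thesis using ij 1 by (auto simp: H_def)
        next
          case False
          have "U $$ (i, j) = 0" using ij False r by (intro U0) auto
          moreover have "H $$ (i, k) = 0 \<or> U $$ (k, j) = 0"
          proof (cases "r \<le> k")
            case True
            then show ?thesis using U0[of k j] ij 1 by simp
          next
            case False': False
            have "k < n - r + (i - (n - r))" using False' False r by linarith
            then have "U $$ (i - (n - r), k) = 0" using U0[of "i - (n - r)" k] ij 1 by simp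
            then show ?thesis using False ij 1 by (simp add: H_def)
          qed
          ultimately show ?thesis by auto
        qed
      qed
      finally show ?case using ij by simp
    qed (use H U in auto)
    have "N = H * U * G"
    proof -
      have "H * U * G = N * H * G" by (simp add: HU NH)
      also have "\<dots> = N" using N H G by (simp add: assoc_mult_mat[of _ n n _ n _ n])
      finally show ?thesis by simp
    qed
    then show ?thesis by (intro similar_matI[OF _ G(2,3)]) (use N H U G in auto)
  qed
  ultimately show ?thesis using that by (simp add: N_def)
qed

text \<open>With \<open>r\<close> the rank of \<open>u\<close>, the multiplicity bound lets the
  eigenvalues of \<open>W\<close> be ordered along a triangular \<open>T\<close> as
  \<open>upper_triangular_add_corner\<close> requires. Then \<open>T' - T\<close> and
  \<open>u\<close> have the same normal form, and a single conjugation carries \<open>T'\<close> and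
  \<open>T\<close> to the two matrices sought.\<close>

lemma square_zero_eq_diff_of_conjugates:
  fixes W :: "'a::alg_closed_field mat"
  assumes W: "W \<in> carrier_mat n n" and mult: "\<And>x. 2 * order x (char_poly W) \<le> n"
    and u: "u \<in> carrier_mat n n" "u * u = 0\<^sub>m n n"
  obtains W1 W2 where "similar_mat W1 W" "similar_mat W2 W" "u = W1 - W2"
proof -
  obtain r where r: "2 * r \<le> n" and sim_u: "similar_mat u (corner_mat n r)"
    using square_zero_similar_corner_mat[OF u] .
  obtain es where es: "char_poly W = (\<Prod>e\<leftarrow>es. [:- e, 1:])" "length es = n"
    using char_poly_splits[OF W] .
  have "2 * count_list es x \<le> length es" for x
    using mult[of x] by (simp add: es order_prod_list_linear)
  then obtain ys where ys: "mset ys = mset es" "\<And>i. i < r \<Longrightarrow> ys ! i \<noteq> ys ! (n - r + i)"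
    using ex_rearrangement_separated[of es r] r es(2) by metis
  have "char_poly W = (\<Prod>e\<leftarrow>ys. [:- e, 1:])"
    unfolding es(1) using ys(1) by (metis mset_map prod_mset_prod_list)
  then obtain T where T: "similar_mat W T" "upper_triangular T" "diag_mat T = ys"
    using ex_upper_triangular_similar[OF W] by blast
  have Tc: "T \<in> carrier_mat n n" using similar_matD[OF T(1)] W by auto
  have "ys ! i = T $$ (i, i)" if "i < n" for i
    using Tc that by (auto simp: T(3)[symmetric] diag_mat_def)
  then have "T $$ (i, i) \<noteq> T $$ (n - r + i, n - r + i)" if "i < r" for i
    using ys(2)[OF that] that r by auto
  then obtain T' where T': "similar_mat T' T" "similar_mat (corner_mat n r) (T' - T)"
    using upper_triangular_add_corner[OF Tc T(2) r] by blast
  have T'c: "T' \<in> carrier_mat n n" using similar_matD[OF T'(1)] Tc by auto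
  obtain P Q where "similar_mat_wit u (T' - T) P Q"
    using similar_mat_trans[OF sim_u T'(2)] by (auto simp: similar_mat_def)
  note PQ = similar_mat_witD2[OF u(1) this]
  have diff: "u = P * T' * Q - P * T * Q"
  proof -
    have "P * (T' - T) = P * T' - P * T"
      by (rule mult_minus_distrib_mat[OF PQ(6) T'c Tc])
    moreover have "(P * T' - P * T) * Q = P * T' * Q - P * T * Q"
      by (rule minus_mult_distrib_mat[OF _ _ PQ(7)]) (use PQ(6) T'c Tc in auto)
    ultimately show ?thesis using PQ(3) by simp
  qed
  have conj: "similar_mat (P * M * Q) M" if "M \<in> carrier_mat n n" for M
    by (rule similar_matI[OF _ PQ(1,2) refl]) (use PQ(6,7) that in auto)
  have "similar_mat (P * T' * Q) W"
    by (rule similar_mat_trans[OF conj[OF T'c] similar_mat_trans[OF T'(1) similar_mat_sym[OF T(1)]]])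
  moreover have "similar_mat (P * T * Q) W"
    by (rule similar_mat_trans[OF conj[OF Tc] similar_mat_sym[OF T(1)]])
  ultimately show ?thesis using diff by (rule that)
qed

section \<open>Clock and shift matrices\<close>

text \<open>The spectrum is stable under multiplication by \<open>w\<close>. For nonzero
  \<open>x\<close> the value \<open>w * x\<close> differs from \<open>x\<close> and has at least its
  multiplicity, while both multiplicities together are at most \<open>n\<close>. The determinant
  excludes the eigenvalue 0.\<close>

lemma order_char_poly_similar_smult:
  fixes Y :: "'a::alg_closed_field mat"
  assumes Y: "Y \<in> carrier_mat n n" and "similar_mat (w \<cdot>\<^sub>m Y) Y" "w \<noteq> 1" "det Y \<noteq> 0"
  shows "2 * order x (char_poly Y) \<le> n"
proof -
  obtain es where es: "char_poly Y = (\<Prod>e\<leftarrow>es. [:- e, 1:])" "length es = n"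
    using char_poly_splits[OF Y] .
  then obtain T where T: "similar_mat Y T" "upper_triangular T" "diag_mat T = es"
    using ex_upper_triangular_similar[OF Y] by blast
  have Tc: "T \<in> carrier_mat n n" using similar_matD[OF T(1)] Y by auto
  have "similar_mat Y (w \<cdot>\<^sub>m T)"
    using similar_mat_trans[OF similar_mat_sym[OF assms(2)] similar_mat_smult[OF T(1)]] .
  then have "char_poly Y = char_poly (w \<cdot>\<^sub>m T)" by (rule char_poly_similar)
  also have "\<dots> = (\<Prod>e\<leftarrow>diag_mat (w \<cdot>\<^sub>m T). [:- e, 1:])"
    using T(2) Tc by (intro char_poly_upper_triangular[of _ n]) (auto simp: upper_triangular_def)
  also have "diag_mat (w \<cdot>\<^sub>m T) = map ((*) w) es"
    using Tc by (auto simp: T(3)[symmetric] diag_mat_def)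
  finally have ord: "order y (char_poly Y) = count_list (map ((*) w) es) y" for y
    by (simp only: order_prod_list_linear)
  have ord': "order y (char_poly Y) = count_list es y" for y
    by (simp only: es(1) order_prod_list_linear)
  have "count_list es x \<le> count_list (map f es) (f x)" for f :: "'a \<Rightarrow> 'a"
    by (induction es) auto
  from this[of "(*) w"] have le: "order x (char_poly Y) \<le> order (w * x) (char_poly Y)"
    by (simp only: ord'[of x] ord[of "w * x"])
  show ?thesis
  proof (cases "x = 0")
    case True
    have "\<not> eigenvalue Y 0"
    proof -
      have "Y + 0 \<cdot>\<^sub>m 1\<^sub>m n = Y" using Y by (intro eq_matI) auto
      then show ?thesis using Y assms(4) by (simp add: eigenvalue_det[OF Y] char_matrix_def)
    qed
    then have "order x (char_poly Y) = 0"
      using True by (simp add: eigenvalue_root_char_poly[OF Y] order_0I)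
    then show ?thesis by simp
  next
    case False
    have "count_list es x + count_list es y \<le> length es" if "x \<noteq> y" for y
      using that by (induction es) auto
    from this[of "w * x"] show ?thesis
      using False assms(3) le ord' es(2) by simp
  qed
qed

locale clock_shift =
  fixes n :: nat and z :: "'a::{alg_closed_field, field_char_0}"
  assumes n_pos: "n > 0" and root: "\<And>k. z ^ k = 1 \<longleftrightarrow> n dvd k"
begin

text \<open>\<open>cs p q\<close> is the \<open>p\<close>-th power of the clock matrix times the \<open>q\<close>-th power of the shift matrix.\<close>

definition cs :: "nat \<Rightarrow> nat \<Rightarrow> 'a mat" where
  "cs p q = mat n n (\<lambda>(i, j). if j = (i + q) mod n then z ^ (p * i) else 0)"

lemma cs_carrier [simp]: "cs p q \<in> carrier_mat n n"
  by (simp add: cs_def)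

lemma cs_dim [simp]: "dim_row (cs p q) = n" "dim_col (cs p q) = n"
  by (auto simp: cs_def)

lemma z_nonzero: "z \<noteq> 0"
proof
  assume "z = 0"
  then have "z ^ n = 0" using n_pos by simp
  then show False using root[of n] n_pos by (simp add: power_0_left)
qed

lemma z_power_mod: "z ^ (p * (k mod n)) = z ^ (p * k)"
proof -
  have "p * k = n * (p * (k div n)) + p * (k mod n)"
    by (metis distrib_left mult_div_mod_eq mult.left_commute)
  then have "z ^ (p * k) = (z ^ n) ^ (p * (k div n)) * z ^ (p * (k mod n))"
    by (metis power_add power_mult)
  then show ?thesis using root[of n] by simp
qed

text \<open>Moving a power of the shift past a power of the clock costs a power of \<open>z\<close>;
  the reduction of row indices modulo \<open>n\<close> is harmless by
  \<open>z_power_mod\<close>.\<close>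

lemma cs_mult: "cs p q * cs p' q' = z ^ (q * p') \<cdot>\<^sub>m cs (p + p') (q + q')"
proof (intro eq_matI, goal_cases)
  case (1 i j)
  then have ij: "i < n" "j < n" by auto
  have "(cs p q * cs p' q') $$ (i, j) = (\<Sum>k\<in>{0..<n}. cs p q $$ (i, k) * cs p' q' $$ (k, j))"
    by (rule index_mult_mat_sum[OF cs_carrier cs_carrier ij])
  also have "\<dots> = (\<Sum>k\<in>{0..<n}. if k = (i + q) mod n then z ^ (p * i) * cs p' q' $$ (k, j) else 0)"
    by (intro sum.cong refl) (use ij in \<open>auto simp: cs_def\<close>)
  also have "\<dots> = z ^ (p * i) * cs p' q' $$ ((i + q) mod n, j)"
    using n_pos by simp
  also have "\<dots> = (if j = (i + (q + q')) mod n then z ^ (p * i) * z ^ (p' * (i + q)) else 0)"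
    using ij n_pos by (simp add: cs_def z_power_mod mod_add_left_eq add.assoc)
  also have "\<dots> = (z ^ (q * p') \<cdot>\<^sub>m cs (p + p') (q + q')) $$ (i, j)"
    using ij by (simp add: cs_def power_add[symmetric] algebra_simps)
  finally show ?case .
qed auto

lemma cs_scalar:
  assumes "n dvd p" "n dvd q"
  shows "cs p q = 1\<^sub>m n"
proof (intro eq_matI, goal_cases)
  case (1 i j)
  have "(i + q) mod n = i" using assms(2) 1 by (metis add.right_neutral index_one_mat(2) mod_add_right_eq mod_less dvd_imp_mod_0)
  moreover have "z ^ (p * i) = 1" using assms(1) root by simp
  ultimately show ?case using 1 by (auto simp: cs_def)
qed auto

text \<open>A factor with complementary exponents makes both exponents divisible by
  \<open>n\<close>, and the product is a nonzero scalar matrix.\<close>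

lemma det_cs_nonzero: "det (cs p q) \<noteq> 0"
proof -
  have "p + (n - 1) * p = n * p" "q + (n - 1) * q = n * q"
    using n_pos by (simp_all flip: mult_Suc)
  then have "cs p q * cs ((n - 1) * p) ((n - 1) * q) = z ^ (q * ((n - 1) * p)) \<cdot>\<^sub>m 1\<^sub>m n"
    by (simp add: cs_mult cs_scalar)
  then have "det (cs p q) * det (cs ((n - 1) * p) ((n - 1) * q)) = (z ^ (q * ((n - 1) * p))) ^ n"
    by (metis cs_carrier det_mult det_one det_smult index_one_mat(3) mult.right_neutral)
  then show ?thesis using z_nonzero by auto
qed

text \<open>The clock and shift matrices commute up to roots of unity, so the spectrum of \<open>cs p q\<close> is
  invariant under a nontrivial rotation.\<close>

lemma order_char_poly_cs:
  assumes "\<not> (n dvd p \<and> n dvd q)" and c: "c \<noteq> 0"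
  shows "2 * order x (char_poly (c \<cdot>\<^sub>m cs p q)) \<le> n"
proof -
  \<comment> \<open>Conjugation by the clock detects a \<open>q\<close> not divisible by
    \<open>n\<close>, conjugation by the shift such a \<open>p\<close>.\<close>
  obtain a b w where R: "cs a b * cs p q = w \<cdot>\<^sub>m (cs p q * cs a b)" and w: "w \<noteq> 1"
  proof (cases "n dvd p")
    case True
    then have q: "\<not> n dvd q" using assms(1) by simp
    have "cs 1 0 * cs p q = inverse (z ^ q) \<cdot>\<^sub>m (cs p q * cs 1 0)"
      using z_nonzero by (intro eq_matI) (auto simp: cs_mult simp del: index_mult_mat(1))
    moreover have "inverse (z ^ q) \<noteq> 1" using root[of q] q by simp
    ultimately show ?thesis using that by blast
  next
    case False
    have "cs 0 1 * cs p q = z ^ p \<cdot>\<^sub>m (cs p q * cs 0 1)"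
      by (intro eq_matI) (auto simp: cs_mult simp del: index_mult_mat(1))
    moreover have "z ^ p \<noteq> 1" using root[of p] False by simp
    ultimately show ?thesis using that by blast
  qed
  define Y where "Y = c \<cdot>\<^sub>m cs p q"
  define R where "R = cs a b"
  have Y: "Y \<in> carrier_mat n n" and Rc: "R \<in> carrier_mat n n" by (auto simp: Y_def R_def)
  have "R * Y = c \<cdot>\<^sub>m (R * cs p q)"
    unfolding Y_def by (rule mult_smult_distrib[OF Rc cs_carrier])
  also have "\<dots> = w \<cdot>\<^sub>m (c \<cdot>\<^sub>m (cs p q * R))"
    by (simp add: R_def R smult_smult_mat mult.commute)
  also have "c \<cdot>\<^sub>m (cs p q * R) = Y * R"
    unfolding Y_def by (rule mult_smult_assoc_mat[OF cs_carrier Rc, symmetric])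
  finally have RY: "R * Y = w \<cdot>\<^sub>m (Y * R)" .
  obtain S where S: "S \<in> carrier_mat n n" "R * S = 1\<^sub>m n" "S * R = 1\<^sub>m n"
    using det_non_zero_imp_unit[OF Rc] det_cs_nonzero[of a b]
    by (auto simp: Units_def ring_mat_simps R_def)
  have "R * Y * S = w \<cdot>\<^sub>m (Y * R * S)"
    unfolding RY by (rule mult_smult_assoc_mat[of _ n n _ n]) (use Y Rc S in auto)
  also have "Y * R * S = Y"
    using Y Rc S by (simp add: assoc_mult_mat[of _ n n _ n _ n])
  finally have "similar_mat (w \<cdot>\<^sub>m Y) Y"
    by (intro similar_matI[OF _ S(2,3)]) (use Y Rc S in auto)
  moreover have "det Y \<noteq> 0" using c det_cs_nonzero by (simp add: Y_def det_smult)
  ultimately show ?thesis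
    using order_char_poly_similar_smult[OF Y _ w] by (simp add: Y_def)
qed

text \<open>\<open>s\<close> and \<open>t\<close> record the powers of the clock and of the shift matrix. At \<open>s = t = 1\<close> every matrix
  is the value of some member, and sums and products of members are members.\<close>

inductive_set twisted :: "('a \<Rightarrow> 'a \<Rightarrow> 'a mat) set" where
  monom: "(\<lambda>s t. (a * s ^ p * t ^ q) \<cdot>\<^sub>m cs p q) \<in> twisted"
| add: "X \<in> twisted \<Longrightarrow> Y \<in> twisted \<Longrightarrow> (\<lambda>s t. X s t + Y s t) \<in> twisted"

lemma twisted_carrier: "X \<in> twisted \<Longrightarrow> X s t \<in> carrier_mat n n"
  by (induction rule: twisted.induct) auto

lemma twisted_smult: "X \<in> twisted \<Longrightarrow> (\<lambda>s t. c \<cdot>\<^sub>m X s t) \<in> twisted"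
proof (induction rule: twisted.induct)
  case (monom a p q)
  then show ?case using twisted.monom[of "c * a" p q] by (simp add: smult_smult_mat mult.assoc)
next
  case (add X Y)
  have "(\<lambda>s t. c \<cdot>\<^sub>m (X s t + Y s t)) = (\<lambda>s t. c \<cdot>\<^sub>m X s t + c \<cdot>\<^sub>m Y s t)"
    using add.hyps twisted_carrier by (intro ext add_smult_distrib_left_mat[of _ n n]) auto
  then show ?case using twisted.add[OF add.IH] by simp
qed

text \<open>The exponents of \<open>s\<close> and \<open>t\<close> add up just as those of the clock
  and the shift do; the commutation factor goes into the coefficient.\<close>

lemma twisted_mult:
  assumes "X \<in> twisted" "Y \<in> twisted"
  shows "(\<lambda>s t. X s t * Y s t) \<in> twisted"
  using assms(1)
proof (induction rule: twisted.induct)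
  case (monom a p q)
  show ?case using assms(2)
  proof (induction rule: twisted.induct)
    case (monom b p' q')
    have "(a * s ^ p * t ^ q) \<cdot>\<^sub>m cs p q * ((b * s ^ p' * t ^ q') \<cdot>\<^sub>m cs p' q')
        = (a * b * z ^ (q * p') * s ^ (p + p') * t ^ (q + q')) \<cdot>\<^sub>m cs (p + p') (q + q')" for s t
      by (simp add: mult_smult_assoc_mat[of _ n n _ n] mult_smult_distrib[of _ n n _ n] cs_mult
          smult_smult_mat power_add mult_ac)
    then show ?case using twisted.monom by simp
  next
    case (add Y Y')
    have "(a * s ^ p * t ^ q) \<cdot>\<^sub>m cs p q * (Y s t + Y' s t)
        = (a * s ^ p * t ^ q) \<cdot>\<^sub>m cs p q * Y s t + (a * s ^ p * t ^ q) \<cdot>\<^sub>m cs p q * Y' s t" for s t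
      by (rule mult_add_distrib_mat[of _ n n _ n]) (use add.hyps twisted_carrier in auto)
    then show ?case using twisted.add[OF add.IH] by simp
  qed
next
  case (add X X')
  have "(X s t + X' s t) * Y s t = X s t * Y s t + X' s t * Y s t" for s t
    by (rule add_mult_distrib_mat[of _ n n _ _ n]) (use add.hyps assms(2) twisted_carrier in auto)
  then show ?case using twisted.add[OF add.IH] by simp
qed

lemma twisted_one: "(\<lambda>s t. 1\<^sub>m n) \<in> twisted"
proof -
  have "(\<lambda>s t. (1 * s ^ 0 * t ^ 0) \<cdot>\<^sub>m cs 0 0) = (\<lambda>s t. 1\<^sub>m n)"
    by (intro ext eq_matI) (auto simp: cs_scalar)
  then show ?thesis using twisted.monom[of 1 0 0] by metis
qed

lemma twisted_sum:
  assumes "finite K" "\<And>k. k \<in> K \<Longrightarrow> X k \<in> twisted"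
  shows "(\<lambda>s t. mat n n (\<lambda>ij. \<Sum>k\<in>K. X k s t $$ ij)) \<in> twisted"
  using assms
proof (induction K rule: finite_induct)
  case empty
  have "(\<lambda>s t. (0 * s ^ 0 * t ^ 0) \<cdot>\<^sub>m cs 0 0) = (\<lambda>s t. mat n n (\<lambda>ij. \<Sum>k\<in>{}. X k s t $$ ij))"
    by (intro ext eq_matI) auto
  then show ?case using twisted.monom[of 0 0 0] by metis
next
  case (insert k K)
  have "mat n n (\<lambda>ij. \<Sum>k\<in>insert k K. X k s t $$ ij)
      = X k s t + mat n n (\<lambda>ij. \<Sum>k\<in>K. X k s t $$ ij)" for s t
    using insert twisted_carrier[of "X k" s t] by (intro eq_matI) auto
  then show ?case using insert twisted.add by simp
qed

section \<open>Lifting matrices and values to twisted families\<close>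

text \<open>Orthogonality of the characters of Z/n, by summing the geometric series of the root of
  unity \<open>w\<close>.\<close>

lemma sum_root_powers:
  assumes "i < n" "k < n"
  shows "(\<Sum>p<n. inverse (z ^ (p * k)) * z ^ (p * i)) = (if i = k then of_nat n else 0)"
proof -
  define w where "w = z ^ i * inverse (z ^ k)"
  have eq: "inverse (z ^ (p * k)) * z ^ (p * i) = w ^ p" for p
    by (simp add: w_def power_mult_distrib power_inverse mult.commute flip: power_mult)
  have ne: "w \<noteq> 1" if "a < b" "b < n" "w = z ^ a * inverse (z ^ b) \<or> w = z ^ b * inverse (z ^ a)" for a b
  proof
    assume "w = 1"
    then have "z ^ a = z ^ b" using that(3) z_nonzero by (auto simp: field_simps)
    also have "\<dots> = z ^ a * z ^ (b - a)" using that(1) by (simp flip: power_add)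
    finally have "z ^ (b - a) = 1" using z_nonzero by simp
    then show False using root that(1,2) by (auto dest: dvd_imp_le)
  qed
  show ?thesis
  proof (cases "i = k")
    case True
    then have "w = 1" using z_nonzero by (simp add: w_def)
    then show ?thesis unfolding eq using True by simp
  next
    case False
    then have "w \<noteq> 1" using ne[of i k] ne[of k i] assms
      by (cases i k rule: linorder_cases) (simp_all add: w_def)
    moreover have "w ^ n = 1"
    proof -
      have "w ^ n = (z ^ n) ^ i * inverse ((z ^ n) ^ k)"
        by (simp add: w_def power_mult_distrib power_inverse mult.commute flip: power_mult)
      then show ?thesis using root[of n] by simp
    qed
    ultimately have "(\<Sum>p<n. w ^ p) = 0" using power_diff_1_eq[of w n] by simp
    then show ?thesis unfolding eq using False by simp
  qed
qed

text \<open>Fourier inversion: averaging the powers of the clock with weights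
  \<open>inverse (z ^ (p * k))\<close> gives the projection to row \<open>k\<close>, and the shift
  by \<open>q\<close> moves its entry to column \<open>l\<close>.\<close>

lemma twisted_lift_unit:
  assumes "k < n" "l < n"
  shows "\<exists>X\<in>twisted. X 1 1 = mat n n (\<lambda>(i, j). if i = k \<and> j = l then 1 else 0)"
proof -
  \<comment> \<open>Adding \<open>n\<close> first keeps the subtraction of naturals exact.\<close>
  define q where "q = (l + n - k) mod n"
  have q: "(k + q) mod n = l" using assms by (simp add: q_def mod_add_right_eq)
  define X where "X = (\<lambda>p s t. inverse (of_nat n) * inverse (z ^ (p * k)) * s ^ p * t ^ q \<cdot>\<^sub>m cs p q)"
  have "X p \<in> twisted" for p
    unfolding X_def by (rule twisted.monom)
  then have "(\<lambda>s t. mat n n (\<lambda>ij. \<Sum>p<n. X p s t $$ ij)) \<in> twisted"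
    by (intro twisted_sum) auto
  moreover have "mat n n (\<lambda>ij. \<Sum>p<n. X p 1 1 $$ ij) = mat n n (\<lambda>(i, j). if i = k \<and> j = l then 1 else 0)"
  proof (intro eq_matI, goal_cases)
    case (1 i j)
    then have ij: "i < n" "j < n" by auto
    have "(\<Sum>p<n. X p 1 1 $$ (i, j))
        = (\<Sum>p<n. inverse (of_nat n) * (if j = (i + q) mod n then 1 else 0)
            * (inverse (z ^ (p * k)) * z ^ (p * i)))"
      using ij by (intro sum.cong) (auto simp: X_def cs_def)
    also have "\<dots> = inverse (of_nat n) * (if j = (i + q) mod n then 1 else 0)
        * (if i = k then of_nat n else 0)"
      unfolding sum_distrib_left[symmetric] using sum_root_powers[OF ij(1) assms(1)] by simp
    also have "\<dots> = (if i = k \<and> j = l then 1 else 0)"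
      using n_pos q by auto
    finally show ?case using ij by simp
  qed auto
  ultimately show ?thesis by (intro bexI[of _ "\<lambda>s t. mat n n (\<lambda>ij. \<Sum>p<n. X p s t $$ ij)"])
qed

lemma twisted_lift:
  assumes x: "x \<in> carrier_mat n n"
  shows "\<exists>X\<in>twisted. X 1 1 = x"
proof -
  define E where "E kl = (SOME X. X \<in> twisted \<and>
    X 1 1 = mat n n (\<lambda>(i, j). if i = fst kl \<and> j = snd kl then 1 else 0))" for kl
  have E: "E kl \<in> twisted \<and> E kl 1 1 = mat n n (\<lambda>(i, j). if i = fst kl \<and> j = snd kl then 1 else 0)"
    if "kl \<in> {..<n} \<times> {..<n}" for kl
  proof -
    have "\<exists>X. X \<in> twisted \<and> X 1 1 = mat n n (\<lambda>(i, j). if i = fst kl \<and> j = snd kl then 1 else 0)"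
      using twisted_lift_unit[of "fst kl" "snd kl"] that by (simp only: mem_Times_iff lessThan_iff Bex_def)
    then show ?thesis unfolding E_def by (rule someI_ex)
  qed
  define X where "X = (\<lambda>s t. mat n n (\<lambda>ij. \<Sum>kl\<in>{..<n} \<times> {..<n}. (x $$ kl \<cdot>\<^sub>m E kl s t) $$ ij))"
  have "X \<in> twisted" unfolding X_def by (intro twisted_sum twisted_smult conjunct1[OF E]) auto
  moreover have "X 1 1 = x"
  proof (intro eq_matI, goal_cases)
    case (1 i j)
    then have ij: "i < n" "j < n" using x by auto
    have "X 1 1 $$ (i, j) = (\<Sum>kl\<in>{..<n} \<times> {..<n}. (x $$ kl \<cdot>\<^sub>m E kl 1 1) $$ (i, j))"
      using ij by (simp add: X_def)
    also have "\<dots> = (\<Sum>kl\<in>{..<n} \<times> {..<n}. if kl = (i, j) then x $$ kl else 0)"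
      by (intro sum.cong refl) (use ij in \<open>auto simp: E\<close>)
    also have "\<dots> = x $$ (i, j)" using ij by simp
    finally show ?case .
  qed (use x in \<open>auto simp: X_def\<close>)
  ultimately show ?thesis by blast
qed

text \<open>Twisted families are closed under all operations that build a value of \<open>f\<close>,
  so the curve through a given value stays inside the image of \<open>f\<close>.\<close>

lemma twisted_nc_eval:
  assumes X: "\<And>i. X i \<in> twisted"
  shows "(\<lambda>s t. nc_eval n (\<lambda>i. X i s t) f) \<in> twisted"
proof (induction f rule: free_algebra_induct)
  case (single w c)
  have "(\<lambda>s t. foldr (\<lambda>i M. X i s t * M) l (1\<^sub>m n)) \<in> twisted" for l
    by (induction l) (auto intro: twisted_one twisted_mult[OF X])
  then have "(\<lambda>s t. c \<cdot>\<^sub>m word_eval n (\<lambda>i. X i s t) w) \<in> twisted"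
    by (intro twisted_smult) (simp add: word_eval_def)
  then show ?case using X twisted_carrier by (simp add: nc_eval_single)
next
  case (add f g)
  then show ?case using X twisted_carrier twisted.add by (simp add: nc_eval_add)
qed

text \<open>Every sufficiently large \<open>D\<close> is allowed so that the expansions of two
  summands can be added over a common range.\<close>

lemma twisted_coeffs:
  assumes "X \<in> twisted"
  shows "\<exists>c D0. \<forall>D\<ge>D0. \<forall>s t. \<forall>i<n. \<forall>j<n. X s t $$ (i, j)
    = (\<Sum>(p, q)\<in>{..D} \<times> {..D}. c p q * s ^ p * t ^ q * cs p q $$ (i, j))"
  using assms
proof (induction rule: twisted.induct)
  case (monom a p q)
  show ?case
  proof (intro exI allI impI)
    fix D s t i j
    assume D: "max p q \<le> D" and ij: "i < n" "j < n"
    have "(\<Sum>(p', q')\<in>{..D} \<times> {..D}. (if (p', q') = (p, q) then a else 0) * s ^ p' * t ^ q' * cs p' q' $$ (i, j))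
        = (\<Sum>x\<in>{..D} \<times> {..D}. if x = (p, q) then a * s ^ p * t ^ q * cs p q $$ (i, j) else 0)"
      by (intro sum.cong refl) (auto split: if_splits)
    also have "\<dots> = a * s ^ p * t ^ q * cs p q $$ (i, j)" using D by simp
    finally show "((a * s ^ p * t ^ q) \<cdot>\<^sub>m cs p q) $$ (i, j)
        = (\<Sum>(p', q')\<in>{..D} \<times> {..D}. (if (p', q') = (p, q) then a else 0) * s ^ p' * t ^ q' * cs p' q' $$ (i, j))"
      using ij by simp
  qed
next
  case (add X Y)
  obtain c D0 where c: "\<And>D s t i j. D0 \<le> D \<Longrightarrow> i < n \<Longrightarrow> j < n \<Longrightarrow> X s t $$ (i, j)
    = (\<Sum>(p, q)\<in>{..D} \<times> {..D}. c p q * s ^ p * t ^ q * cs p q $$ (i, j))"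
    using add.IH(1) by blast
  obtain c' D0' where c': "\<And>D s t i j. D0' \<le> D \<Longrightarrow> i < n \<Longrightarrow> j < n \<Longrightarrow> Y s t $$ (i, j)
    = (\<Sum>(p, q)\<in>{..D} \<times> {..D}. c' p q * s ^ p * t ^ q * cs p q $$ (i, j))"
    using add.IH(2) by blast
  show ?case
  proof (intro exI allI impI)
    fix D s t i j
    assume D: "max D0 D0' \<le> D" and ij: "i < n" "j < n"
    show "(X s t + Y s t) $$ (i, j)
        = (\<Sum>(p, q)\<in>{..D} \<times> {..D}. (c p q + c' p q) * s ^ p * t ^ q * cs p q $$ (i, j))"
      using D ij c[of D i j s t] c'[of D i j s t] twisted_carrier[OF add.hyps(2), of s t]
      by (simp add: case_prod_unfold distrib_right sum.distrib)
  qed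
qed

end

section \<open>Values of noncommutative polynomials\<close>

lemma nc_eval_conjugate:
  assumes x: "\<And>i. x i \<in> carrier_mat n n"
    and PQ: "P \<in> carrier_mat n n" "Q \<in> carrier_mat n n" "P * Q = 1\<^sub>m n" "Q * P = 1\<^sub>m n"
  shows "nc_eval n (\<lambda>i. P * x i * Q) f = P * nc_eval n x f * Q"
proof -
  have x': "P * x i * Q \<in> carrier_mat n n" for i using x PQ by auto
  note c = nc_eval_closed[of x n, OF x] and wc = word_eval_closed[of x n, OF x]
  show ?thesis
  proof (induction f rule: free_algebra_induct)
    case (single w c)
    have "word_eval n (\<lambda>i. P * x i * Q) (Word l) = P * word_eval n x (Word l) * Q" for l
    proof (induction l)
      case Nil
      show ?case using PQ by (simp add: word_eval_def)
    next
      case (Cons i l)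
      then show ?case using conjugate_mult[OF PQ(1,2,4) x wc, of i "Word l"] by (simp add: word_eval_def)
    qed
    from this[of "letters w"]
    have "word_eval n (\<lambda>i. P * x i * Q) w = P * word_eval n x w * Q" by simp
    then show ?case
      using PQ wc by (simp add: nc_eval_single[OF x] nc_eval_single[OF x']
          mult_smult_distrib[OF PQ(1) wc] mult_smult_assoc_mat[of _ n n _ n])
  next
    case (add f g)
    have "P * (nc_eval n x f + nc_eval n x g) * Q
        = P * nc_eval n x f * Q + P * nc_eval n x g * Q"
      using PQ(1,2) c by (simp add: mult_add_distrib_mat[OF PQ(1) c c] add_mult_distrib_mat[of _ n n _ _ n])
    then show ?case by (simp add: nc_eval_add[OF x] nc_eval_add[OF x'] add)
  qed
qed

text \<open>Conjugation is an automorphism of the matrix algebra, so conjugating the assignment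
  conjugates the value.\<close>

lemma nc_image_similar:
  assumes "M \<in> nc_image n f" "similar_mat N M"
  shows "N \<in> nc_image n f"
proof -
  obtain x where x: "\<And>i. x i \<in> carrier_mat n n" "M = nc_eval n x f"
    using assms(1) by (auto simp: nc_image_def)
  have M: "M \<in> carrier_mat n n" unfolding x(2) by (rule nc_eval_closed) (rule x(1))
  obtain P Q where "similar_mat_wit N M P Q" using assms(2) by (auto simp: similar_mat_def)
  moreover have "N \<in> carrier_mat n n" using similar_matD[OF assms(2)] M by auto
  ultimately have PQ: "P * Q = 1\<^sub>m n" "Q * P = 1\<^sub>m n" "N = P * M * Q" "P \<in> carrier_mat n n" "Q \<in> carrier_mat n n"
    using similar_mat_witD2[of N n n M P Q] by auto
  have "N = nc_eval n (\<lambda>i. P * x i * Q) f"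
    using nc_eval_conjugate[OF x(1) PQ(4,5,1,2)] PQ(3) x(2) by simp
  moreover have "P * x i * Q \<in> carrier_mat n n" for i using PQ(4,5) x(1) by auto
  ultimately show ?thesis unfolding nc_image_def by blast
qed

context clock_shift
begin

section \<open>Square-zero matrices from a generic specialisation\<close>

text \<open>Substituting \<open>s = \<tau>\<close> and \<open>t = \<tau> ^ (Suc D)\<close> gives the
  nonscalar terms of \<open>Z\<close> different exponents. Freed of the scalar part and of the
  lowest power of \<tau>, the family becomes a polynomial matrix with value
  \<open>c p0 q0 \<cdot>\<^sub>m cs p0 q0\<close> at 0, and the multiplicity bound passes from 0 to
  some nonzero \<tau>.\<close>

lemma square_zero_in_twisted_image:
  assumes Z: "Z \<in> twisted" and nonscalar: "Z 1 1 \<notin> mat_center n"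
    and u: "u \<in> carrier_mat n n" "u * u = 0\<^sub>m n n"
  obtains s t V1 V2 where "similar_mat V1 (Z s t)" "similar_mat V2 (Z s t)" "u = V1 - V2"
proof -
  obtain c D where c: "\<And>s t i j. i < n \<Longrightarrow> j < n \<Longrightarrow> Z s t $$ (i, j)
    = (\<Sum>(p, q)\<in>{..D} \<times> {..D}. c p q * s ^ p * t ^ q * cs p q $$ (i, j))"
    using twisted_coeffs[OF Z] by blast
  \<comment> \<open>By \<open>cs_scalar\<close> the terms of \<open>C\<close> sum to a scalar
    matrix, which conjugation does not change; \<open>B\<close> keeps the rest.\<close>
  define C where "C = {(p, q) \<in> {..D} \<times> {..D}. n dvd p \<and> n dvd q}"
  define B where "B = {(p, q) \<in> {..D} \<times> {..D}. c p q \<noteq> 0 \<and> \<not> (n dvd p \<and> n dvd q)}"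
  have fin: "finite B" "finite C"
    by (auto simp: B_def C_def intro: finite_subset[of _ "{..D} \<times> {..D}"])
  define k where "k s t = (\<Sum>(p, q)\<in>C. c p q * s ^ p * t ^ q)" for s t
  have split: "Z s t $$ (i, j) = k s t * 1\<^sub>m n $$ (i, j)
      + (\<Sum>(p, q)\<in>B. c p q * s ^ p * t ^ q * cs p q $$ (i, j))" if ij: "i < n" "j < n" for s t i j
  proof -
    have "Z s t $$ (i, j) = (\<Sum>(p, q)\<in>C \<union> B. c p q * s ^ p * t ^ q * cs p q $$ (i, j))"
      unfolding c[OF ij] by (intro sum.mono_neutral_right) (auto simp: B_def C_def)
    also have "\<dots> = (\<Sum>(p, q)\<in>C. c p q * s ^ p * t ^ q * cs p q $$ (i, j))
        + (\<Sum>(p, q)\<in>B. c p q * s ^ p * t ^ q * cs p q $$ (i, j))"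
      using fin by (intro sum.union_disjoint) (auto simp: B_def C_def)
    also have "(\<Sum>(p, q)\<in>C. c p q * s ^ p * t ^ q * cs p q $$ (i, j)) = k s t * 1\<^sub>m n $$ (i, j)"
      unfolding k_def sum_distrib_right by (intro sum.cong) (auto simp: C_def cs_scalar)
    finally show ?thesis .
  qed
  have "B \<noteq> {}"
  proof
    assume "B = {}"
    then have Z1: "Z 1 1 = k 1 1 \<cdot>\<^sub>m 1\<^sub>m n"
      using twisted_carrier[OF Z] split[of _ _ 1 1] by (intro eq_matI) auto
    have "Z 1 1 \<in> mat_center n"
      unfolding mat_center_def Z1
      by (auto simp: mult_smult_distrib[of _ n n _ n] mult_smult_assoc_mat[of _ n n _ n])
    then show False using nonscalar by simp
  qed
  \<comment> \<open>The exponent of \<tau> after the substitution. As \<open>p \<le> D\<close>, both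
    \<open>p\<close> and \<open>q\<close> can be recovered from it by division by
    \<open>Suc D\<close>.\<close>
  define e where "e = (\<lambda>(p, q). p + Suc D * q)"
  have e_inj: "x = y" if "x \<in> B" "y \<in> B" "e x = e y" for x y
  proof -
    have "p = e (p, q) mod (Suc D) \<and> q = e (p, q) div (Suc D)" if "(p, q) \<in> B" for p q
    proof -
      have "p < Suc D" using that by (simp add: B_def)
      then show ?thesis by (simp only: e_def prod.case mod_mult_self2 div_mult_self2 mod_less div_less) simp
    qed
    then show ?thesis using that by (metis surj_pair)
  qed
  obtain p0 q0 where x0: "(p0, q0) \<in> B" and min: "\<And>x. x \<in> B \<Longrightarrow> e (p0, q0) \<le> e x"
  proof -
    obtain x where "x \<in> B" "\<And>y. y \<in> B \<Longrightarrow> e x \<le> e y"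
      using \<open>B \<noteq> {}\<close> ex_has_least_nat[of "\<lambda>x. x \<in> B" _ e] by blast
    then show ?thesis using that by (cases x) auto
  qed
  define d where "d = e (p0, q0)"
  define A :: "'a poly mat" where
    "A = mat n n (\<lambda>ij. \<Sum>(p, q)\<in>B. Polynomial.monom (c p q * cs p q $$ ij) (e (p, q) - d))"
  define ev where "ev \<tau> = map_mat (\<lambda>q. poly q \<tau>) A" for \<tau>
  have A: "A \<in> carrier_mat n n" by (simp add: A_def)
  have ev_c: "ev \<tau> \<in> carrier_mat n n" for \<tau> using A by (simp add: ev_def)
  have ev_entry: "ev \<tau> $$ (i, j) = (\<Sum>(p, q)\<in>B. c p q * \<tau> ^ (e (p, q) - d) * cs p q $$ (i, j))"
    if "i < n" "j < n" for \<tau> i j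
    using that by (simp add: ev_def A_def poly_sum case_prod_unfold poly_monom mult_ac)
  have Z_ev: "Z \<tau> (\<tau> ^ (Suc D)) = k \<tau> (\<tau> ^ (Suc D)) \<cdot>\<^sub>m 1\<^sub>m n + \<tau> ^ d \<cdot>\<^sub>m ev \<tau>" for \<tau>
  proof (intro eq_matI, goal_cases)
    case (1 i j)
    then have ij: "i < n" "j < n" using ev_c[of \<tau>] by auto
    have "(\<Sum>(p, q)\<in>B. c p q * \<tau> ^ p * (\<tau> ^ (Suc D)) ^ q * cs p q $$ (i, j)) = \<tau> ^ d * ev \<tau> $$ (i, j)"
      unfolding ev_entry[OF ij] sum_distrib_left
    proof (intro sum.cong refl, clarify)
      fix p q assume pq: "(p, q) \<in> B"
      have "\<tau> ^ p * (\<tau> ^ (Suc D)) ^ q = \<tau> ^ e (p, q)"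
        unfolding e_def power_mult[symmetric] power_add[symmetric] by simp
      also have "\<dots> = \<tau> ^ d * \<tau> ^ (e (p, q) - d)"
        using min[OF pq] by (simp add: d_def flip: power_add)
      finally show "c p q * \<tau> ^ p * (\<tau> ^ (Suc D)) ^ q * cs p q $$ (i, j)
          = \<tau> ^ d * (c p q * \<tau> ^ (e (p, q) - d) * cs p q $$ (i, j))"
        by (simp add: mult_ac)
    qed
    then show ?case using split[OF ij, of \<tau> "\<tau> ^ (Suc D)"] ij ev_c[of \<tau>] by simp
  qed (use carrier_matD[OF ev_c] carrier_matD[OF twisted_carrier[OF Z]] in simp_all)
  have ev0: "ev 0 = c p0 q0 \<cdot>\<^sub>m cs p0 q0"
  proof (intro eq_matI, goal_cases)
    case (1 i j)
    then have ij: "i < n" "j < n" by auto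
    \<comment> \<open>Since \<open>0 ^ 0 = 1\<close>, exactly the term of least exponent
      survives.\<close>
    have "ev 0 $$ (i, j) = (\<Sum>x\<in>B. if x = (p0, q0) then c p0 q0 * cs p0 q0 $$ (i, j) else 0)"
      unfolding ev_entry[OF ij]
    proof (intro sum.cong refl, clarify)
      fix p q assume pq: "(p, q) \<in> B"
      have "e (p, q) - d = 0 \<longleftrightarrow> (p, q) = (p0, q0)"
        using min[OF pq] e_inj[OF pq x0] by (auto simp: d_def)
      then show "c p q * 0 ^ (e (p, q) - d) * cs p q $$ (i, j)
          = (if (p, q) = (p0, q0) then c p0 q0 * cs p0 q0 $$ (i, j) else 0)"
        by (auto simp: power_0_left)
    qed
    then show ?case using ij fin x0 by simp
  qed (use ev_c[of 0] in auto)
  have "order x (char_poly (ev 0)) \<le> n div 2" for x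
    using order_char_poly_cs[of p0 q0 "c p0 q0" x] x0 by (simp add: ev0 B_def)
  then have "finite {\<tau>. \<exists>x. order x (char_poly (ev \<tau>)) > n div 2}"
    unfolding ev_def by (intro finite_large_order_specialisations[OF A])
  \<comment> \<open>The value 0 is avoided because the factor \<open>\<tau> ^ d\<close> has to be
    inverted.\<close>
  then obtain \<tau> where \<tau>: "\<tau> \<noteq> 0" "\<And>x. order x (char_poly (ev \<tau>)) \<le> n div 2"
    using ex_new_if_finite[OF infinite_UNIV_char_0, of "insert 0 {\<tau>. \<exists>x. order x (char_poly (ev \<tau>)) > n div 2}"]
    by (auto simp: not_less)
  \<comment> \<open>The rescaling compensates for the factor \<open>\<tau> ^ d\<close> between
    \<open>ev \<tau>\<close> and the nonscalar part of \<open>Z\<close>.\<close>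
  define u' where "u' = inverse (\<tau> ^ d) \<cdot>\<^sub>m u"
  have "u' * u' = 0\<^sub>m n n"
    using u by (simp add: u'_def mult_smult_assoc_mat[of _ n n _ n] mult_smult_distrib[of _ n n _ n])
  moreover have "2 * order x (char_poly (ev \<tau>)) \<le> n" for x using \<tau>(2)[of x] by simp
  ultimately obtain W1 W2 where W: "similar_mat W1 (ev \<tau>)" "similar_mat W2 (ev \<tau>)" "u' = W1 - W2"
    using square_zero_eq_diff_of_conjugates[OF ev_c, of \<tau> u'] u(1) unfolding u'_def by auto
  \<comment> \<open>The scalar part is fixed by every conjugation and cancels in
    \<open>V W1 - V W2\<close>.\<close>
  define V where "V W = k \<tau> (\<tau> ^ (Suc D)) \<cdot>\<^sub>m 1\<^sub>m n + \<tau> ^ d \<cdot>\<^sub>m W" for W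
  have sim: "similar_mat (V W) (Z \<tau> (\<tau> ^ (Suc D)))" if "similar_mat W (ev \<tau>)" for W
  proof -
    obtain P Q where w: "similar_mat_wit W (ev \<tau>) P Q" using \<open>similar_mat W (ev \<tau>)\<close> by (auto simp: similar_mat_def)
    have Wc: "W \<in> carrier_mat n n" using similar_matD[OF that] ev_c[of \<tau>] by auto
    note PQ = similar_mat_witD2[OF Wc w]
    define r where "r = k \<tau> (\<tau> ^ (Suc D))"
    have "P * (r \<cdot>\<^sub>m 1\<^sub>m n + \<tau> ^ d \<cdot>\<^sub>m ev \<tau>) * Q
        = P * (r \<cdot>\<^sub>m 1\<^sub>m n) * Q + P * (\<tau> ^ d \<cdot>\<^sub>m ev \<tau>) * Q"
      using PQ(5-7) by (simp add: mult_add_distrib_mat[of _ n n _ n] add_mult_distrib_mat[of _ n n _ _ n])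
    also have "P * (r \<cdot>\<^sub>m 1\<^sub>m n) * Q = r \<cdot>\<^sub>m 1\<^sub>m n"
      using PQ(1,6,7) by (simp add: mult_smult_distrib[of _ n n _ n] mult_smult_assoc_mat[of _ n n _ n])
    also have "P * (\<tau> ^ d \<cdot>\<^sub>m ev \<tau>) * Q = \<tau> ^ d \<cdot>\<^sub>m W"
      unfolding PQ(3) using PQ(5-7) by (simp add: mult_smult_distrib[of _ n n _ n] mult_smult_assoc_mat[of _ n n _ n])
    finally have "V W = P * Z \<tau> (\<tau> ^ (Suc D)) * Q" by (simp only: V_def r_def Z_ev)
    then show ?thesis
      by (intro similar_matI[OF _ PQ(1,2)]) (use PQ Wc twisted_carrier[OF Z] in \<open>auto simp: V_def\<close>)
  qed
  have Wc: "W1 \<in> carrier_mat n n" "W2 \<in> carrier_mat n n"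
    using similar_matD[OF W(1)] similar_matD[OF W(2)] ev_c[of \<tau>] by auto
  have "u = \<tau> ^ d \<cdot>\<^sub>m u'"
    using \<tau>(1) by (simp add: u'_def smult_smult_mat) (intro eq_matI, auto)
  also have "\<dots> = V W1 - V W2"
    unfolding W(3) V_def using Wc by (intro eq_matI) (auto simp: right_diff_distrib)
  finally show ?thesis using that sim[OF W(1)] sim[OF W(2)] by blast
qed

end

theorem theorem3p18:
  fixes n :: nat
    and f :: "'a::{alg_closed_field, field_char_0} free_algebra"
  assumes "n \<ge> 2"
    and "\<not> is_identity n f"
    and "\<not> is_central_polynomial n f"
  shows "{u \<in> carrier_mat n n. u * u = 0\<^sub>m n n} \<subseteq> {t - t' | t t'. t \<in> nc_image n f \<and> t' \<in> nc_image n f}"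
proof clarify
  fix u :: "'a mat"
  assume u: "u \<in> carrier_mat n n" "u * u = 0\<^sub>m n n"
  obtain z :: 'a where "\<And>k. z ^ k = 1 \<longleftrightarrow> n dvd k"
    using ex_primitive_root_of_unity[of n] assms(1) by auto
  then interpret clock_shift n z by unfold_locales (use assms(1) in auto)
  \<comment> \<open>If all values were central, \<open>f\<close> would be an identity or a central
    polynomial.\<close>
  obtain x where x: "\<And>i. x i \<in> carrier_mat n n" "nc_eval n x f \<notin> mat_center n"
    using assms(2,3) by (auto simp: is_central_polynomial_def nc_image_def)
  obtain X where X: "\<And>i. X i \<in> twisted" "\<And>i. X i 1 1 = x i"
    using twisted_lift[OF x(1)] by metis
  have ns: "nc_eval n (\<lambda>i. X i 1 1) f \<notin> mat_center n" using x(2) by (simp add: X(2))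
  obtain s t V1 V2 where V: "similar_mat V1 (nc_eval n (\<lambda>i. X i s t) f)"
    "similar_mat V2 (nc_eval n (\<lambda>i. X i s t) f)" "u = V1 - V2"
    using square_zero_in_twisted_image[OF twisted_nc_eval[where X = X and f = f, OF X(1)] ns u] .
  have "nc_eval n (\<lambda>i. X i s t) f \<in> nc_image n f"
    using twisted_carrier[OF X(1)] by (auto simp: nc_image_def)
  then show "\<exists>t t'. u = t - t' \<and> t \<in> nc_image n f \<and> t' \<in> nc_image n f"
    using V nc_image_similar by blast
qed

end
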